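(* Let $(\mathbf{n}_\kappa)_{\kappa\ge 1}$ be a sequence of degree statistics such that $|\mathbf{n}_\kappa|\to\infty$ as $\kappa\to\infty$ and such that, for every $i\ge 0$, $p_i(\mathbf{n}_\kappa)\to p_i$ as $\kappa\to\infty$, where $\mathbf{p}=(p_i)_{i\ge 0}$ is a probability distribution on $\mathbb{N}_0$. For $\kappa\ge 1$ let $T_\kappa\in\mathbb{T}$, with $m_\kappa:=|T_\kappa|$, be such that as $\kappa\to\infty$, $$\frac{m_\kappa^2\,\mathbb{E}[N_{T_\kappa}(\mathcal{T}_{\mathbf{n}_\kappa})]}{|\mathbf{n}_\kappa|}\sum_{i\in\mathcal{D}(T_\kappa)}\frac{p_i(\mathbf{n}_{T_\kappa})^2}{p_i(\mathbf{n}_\kappa)}=o(1).$$ Then, as $\kappa\to\infty$: (i) If $\mathbb{E}[N_{T_\kappa}(\mathcal{T}_{\mathbf{n}_\kappa})]\to\lambda$ for some $\lambda\in[0,\infty)$, then $N_{T_\kappa}(\mathcal{T}_{\mathbf{n}_\kappa})$ converges in distribution to $\mathrm{Po}(\lambda)$. (ii) If $\mathbb{E}[N_{T_\kappa}(\mathcal{T}_{\mathbf{n}_\kappa})]\to\infty$, then $$\frac{N_{T_\kappa}(\mathcal{T}_{\mathbf{n}_\kappa})-\mathbb{E}[N_{T_\kappa}(\mathcal{T}_{\mathbf{n}_\kappa})]}{\sqrt{\mathbb{E}[N_{T_\kappa}(\mathcal{T}_{\mathbf{n}_\kappa})]}}$$ converges in distribution to $\mathrm{N}(0,1)$.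
   Context: $\mathbb{N}_0=\{0,1,2,\dots\}$. $\mathbb{T}$ is the set of all finite rooted plane (ordered) trees (up to isomorphism of plane rooted trees); $|T|$ is the number of vertices of $T$, and $d_T(v)$ is the (out)degree, i.e. number of children, of $v\in T$. The degree statistic of $T$ is $\mathbf{n}_T=(n_T(i))_{i\ge 0}$ with $n_T(i)=\#\{v\in T: d_T(v)=i\}$, and $\mathcal{D}(T)=\{i\ge 0:n_T(i)>0\}$. A sequence $\mathbf{n}=(n(i))_{i\ge 0}$ of nonnegative integers is called a degree statistic if $\sum_{i\ge 0}n(i)=1+\sum_{i\ge 0}i\,n(i)<\infty$. Put $|\mathbf{n}|=\sum_i n(i)$ and $p_i(\mathbf{n})=n(i)/|\mathbf{n}|$ (in particular $p_i(\mathbf{n}_T)=n_T(i)/|T|$). $\mathbb{T}_{\mathbf{n}}$ is the (finite, nonempty) set of plane rooted trees with degree statistic $\mathbf{n}$, and $\mathcal{T}_{\mathbf{n}}$ is a uniformly random element of $\mathbb{T}_{\mathbf{n}}$. For $v\in T$, the fringe tree $T_v$ is the subtree of $T$ consisting of $v$ and all its descendants, rooted at $v$. For $T,T'\in\mathbb{T}$, $N_{T'}(T)=\#\{v\in T: T_v=T'\}$, where equality means isomorphism as plane rooted trees. $\mathrm{Po}(\lambda)$ is the Poisson distribution with mean $\lambda$ ($\mathrm{Po}(0)$ is the point mass at $0$); $\mathrm{N}(0,1)$ is the standard normal distribution. If $p_i(\mathbf{n}_\kappa)=0$ for some $i\in\mathcal{D}(T_\kappa)$, then $\mathbb{E}[N_{T_\kappa}(\mathcal{T}_{\mathbf{n}_\kappa})]=0$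 and the hypothesis is read with $0\cdot\infty=0$. *)

theory Defs
  imports "HOL-Probability.Probability" "HOL-Library.Landau_Symbols"
begin

section \<open>Plane rooted trees\<close>

text \<open>Each isomorphism class of finite rooted plane trees is represented by exactly one value of
  this type, so isomorphism of plane rooted trees is equality.\<close>

datatype plane_tree = Node (children: "plane_tree list")

text \<open>Vertices are addressed by their path from the root, the \<open>i\<close>-th child (counted from \<open>0\<close>) of the
  vertex \<open>v\<close> being \<open>v @ [i]\<close>.\<close>

primrec is_vertex :: "nat list \<Rightarrow> plane_tree \<Rightarrow> bool" where
  "is_vertex [] T \<longleftrightarrow> True"
| "is_vertex (i # v) T \<longleftrightarrow> i < length (children T) \<and> is_vertex v (children T ! i)"

definition vertices :: "plane_tree \<Rightarrow> nat list set" where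
  "vertices T = {v. is_vertex v T}"

text \<open>The fringe tree of \<open>T\<close> at \<open>v\<close>; only meaningful for \<open>v \<in> vertices T\<close>.\<close>

primrec fringe_tree :: "plane_tree \<Rightarrow> nat list \<Rightarrow> plane_tree" where
  "fringe_tree T [] = T"
| "fringe_tree T (i # v) = fringe_tree (children T ! i) v"

definition tree_size :: "plane_tree \<Rightarrow> nat" where
  "tree_size T = card (vertices T)"

definition degree_at :: "plane_tree \<Rightarrow> nat list \<Rightarrow> nat" where
  "degree_at T v = length (children (fringe_tree T v))"

definition degree_stat :: "plane_tree \<Rightarrow> nat \<Rightarrow> nat" where
  "degree_stat T i = card {v \<in> vertices T. degree_at T v = i}"

definition degree_set :: "plane_tree \<Rightarrow> nat set" where
  "degree_set T = {i. degree_stat T i > 0}"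

definition fringe_count :: "plane_tree \<Rightarrow> plane_tree \<Rightarrow> nat" where
  "fringe_count T' T = card {v \<in> vertices T. fringe_tree T v = T'}"

lemma finite_vertices: "finite (vertices T)"
proof (induction T)
  case (Node ts)
  have "vertices (Node ts) \<subseteq> insert [] (\<Union>i<length ts. (#) i ` vertices (ts ! i))"
  proof
    fix v assume "v \<in> vertices (Node ts)"
    then show "v \<in> insert [] (\<Union>i<length ts. (#) i ` vertices (ts ! i))"
      by (cases v) (auto simp: vertices_def)
  qed
  moreover have "finite (insert [] (\<Union>i<length ts. (#) i ` vertices (ts ! i)))"
    using Node by auto
  ultimately show ?case by (rule finite_subset)
qed

lemma finite_degree_set: "finite (degree_set T)"
proof (rule finite_subset)
  show "degree_set T \<subseteq> degree_at T ` vertices T"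
    by (auto simp: degree_set_def degree_stat_def card_gt_0_iff)
  show "finite (degree_at T ` vertices T)"
    by (simp add: finite_vertices)
qed

section \<open>Degree statistics\<close>

text \<open>The series are series of natural numbers (discrete topology), so that summability means that
  the sum is finite.\<close>

definition is_degree_statistic :: "(nat \<Rightarrow> nat) \<Rightarrow> bool" where
  "is_degree_statistic n \<longleftrightarrow>
     summable n \<and> summable (\<lambda>i. i * n i) \<and> (\<Sum>i. n i) = 1 + (\<Sum>i. i * n i)"

definition stat_size :: "(nat \<Rightarrow> nat) \<Rightarrow> nat" where
  "stat_size n = (\<Sum>i. n i)"

definition stat_prob :: "(nat \<Rightarrow> nat) \<Rightarrow> nat \<Rightarrow> real" where
  "stat_prob n i = real (n i) / real (stat_size n)"

definition trees_of_stat :: "(nat \<Rightarrow> nat) \<Rightarrow> plane_tree set" where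
  "trees_of_stat n = {T. degree_stat T = n}"

section \<open>Random trees with a given degree statistic\<close>

text \<open>Only meaningful for degree statistics \<open>n\<close>, for which \<open>trees_of_stat n\<close> is finite and
  nonempty.\<close>

definition random_tree :: "(nat \<Rightarrow> nat) \<Rightarrow> plane_tree pmf" where
  "random_tree n = pmf_of_set (trees_of_stat n)"

text \<open>If \<open>stat_prob n i = 0\<close> for some \<open>i \<in> degree_set T'\<close>, then no tree with degree statistic \<open>n\<close> has
  \<open>T'\<close> as a fringe tree and \<open>mean_fringe_count T' n = 0\<close>. A product of this mean with terms divided by
  \<open>stat_prob n i\<close> is then \<open>0\<close> under the convention \<open>x / 0 = 0\<close>, in agreement with reading
  \<open>0 \<cdot> \<infinity>\<close> as \<open>0\<close>.\<close>

definition mean_fringe_count :: "plane_tree \<Rightarrow> (nat \<Rightarrow> nat) \<Rightarrow> real" where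
  "mean_fringe_count T' n = measure_pmf.expectation (random_tree n) (\<lambda>T. real (fringe_count T' T))"

section \<open>Poisson distribution\<close>

text \<open>The library's \<open>poisson_pmf\<close> is specified only for a positive rate.\<close>

definition poisson_dist :: "real \<Rightarrow> nat pmf" where
  "poisson_dist r = (if r = 0 then return_pmf 0 else poisson_pmf r)"

end

theory Submission
  imports Defs "HOL-Combinatorics.Permutations"
begin

text \<open>Read a plane tree in preorder and write down the degrees of its vertices. The fringe trees of
  \<open>T\<close> equal to \<open>T'\<close> are then exactly the occurrences of the word \<open>w\<close> of \<open>T'\<close> as a factor of the word
  of \<open>T\<close>, and by the cycle lemma every arrangement of the degree multiset has exactly one rotation that
  is the word of a tree. So the fringe count in a uniform random tree has the same law as
  the number \<open>X\<close> of cyclic occurrences of \<open>w\<close> in \<open>d \<circ> \<sigma>\<close>, where \<open>\<sigma>\<close> is a uniform permutation of the \<open>N\<close>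
  vertices and \<open>d\<close> gives their degrees (\<open>average_trees_eq_average_permutations\<close>).

  Tree words have no proper border, so that two occurrences of \<open>w\<close> never overlap. Conditionally on an
  occurrence at position \<open>0\<close> one therefore has \<open>X = 1 + Z\<close>, where \<open>Z\<close> counts the occurrences that avoid
  the first \<open>m\<close> positions, \<open>m\<close> being the length of \<open>w\<close>. A coupling shows that \<open>Z\<close> conditionally on this occurrence is close
  to \<open>X\<close> without conditioning: take a conditioned permutation \<open>\<sigma>'\<close>, choose independently a uniform list of
  \<open>m\<close> distinct positions, and send the \<open>m\<close> vertices of the block to these positions, the
  displaced vertices going into the block. The result is uniform, and only occurrences touching the moved
  vertices are affected. With \<open>\<mu>\<close> the mean of \<open>X\<close>, \<open>t\<^sub>i\<close> the number of letters \<open>i\<close> in \<open>w\<close> and \<open>n\<^sub>i\<close> the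
  number of vertices of degree \<open>i\<close>, a vertex of degree \<open>i\<close> lies in an occurrence with probability
  \<open>\<mu> t\<^sub>i / n\<^sub>i\<close>; summing over the moved vertices gives an error of order \<open>\<mu> L\<close> with
  \<open>L = \<Sum>\<^sub>i t\<^sub>i\<^sup>2 / n\<^sub>i\<close>, which also dominates \<open>\<mu> m\<^sup>2 / N\<close> by the Cauchy-Schwarz inequality
  (\<open>coupling_bound\<close>, for \<open>L \<le> 1 / 2\<close>). The quantity that the theorem assumes to vanish is exactly \<open>\<mu> L\<close>, so
  that \<open>L \<rightarrow> 0\<close> unless \<open>\<mu>\<close> comes close to \<open>0\<close>.

  Let \<open>\<phi>(t) = E exp(i t X)\<close>. Its derivative is \<open>i E (X exp(i t X))\<close>, which by size biasing is
  \<open>i \<mu>\<close> times the conditional mean of \<open>exp(i t (1 + Z))\<close>, hence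
  \<open>\<phi>'(t) = i \<mu> exp(i t) \<phi>(t)\<close> up to an error of at most \<open>5 \<mu>\<^sup>2 L |t|\<close> (\<open>size_bias_bound\<close>). Without the
  error this is the differential equation of the Poisson characteristic function, and integrating it gives
  \<open>|\<phi>(t) - exp(\<mu> (exp(i t) - 1))| \<le> 5 \<mu>\<^sup>2 L t\<^sup>2\<close> for \<open>|t| \<le> \<pi>\<close>, and the same with an additional factor
  \<open>exp(2 \<mu>)\<close> for all \<open>t\<close> (\<open>poisson_comparison\<close>). If \<open>\<mu>\<close> converges to a positive
  number, this yields the Poisson limit; if \<open>\<mu> \<rightarrow> 0\<close>, then \<open>X = 0\<close> with probability tending to \<open>1\<close>. For
  \<open>\<mu> \<rightarrow> \<infinity>\<close> put \<open>t / \<surd>\<mu>\<close> in place of \<open>t\<close>: the error is \<open>5 \<mu> L t\<^sup>2\<close>, and a normalised Poisson variable is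
  asymptotically normal. In each case Levy's continuity theorem concludes.\<close>

section \<open>Preorder degree words of plane trees\<close>

primrec fringe_trees :: "plane_tree \<Rightarrow> plane_tree list" where
  "fringe_trees (Node ts) = Node ts # concat (map fringe_trees ts)"

definition preorder_degrees :: "plane_tree \<Rightarrow> nat list" where
  "preorder_degrees T = map (\<lambda>t. length (children t)) (fringe_trees T)"

lemma preorder_degrees_Node:
  "preorder_degrees (Node ts) = length ts # concat (map preorder_degrees ts)"
  by (simp add: preorder_degrees_def[abs_def] map_concat comp_def)

lemma vertices_Node:
  "vertices (Node ts) = insert [] (\<Union>i<length ts. (#) i ` vertices (ts ! i))"
proof -
  have "v \<in> vertices (Node ts) \<longleftrightarrow> v \<in> insert [] (\<Union>i<length ts. (#) i ` vertices (ts ! i))" for v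
    by (cases v) (auto simp: vertices_def)
  then show ?thesis by blast
qed

text \<open>Tree size, degree statistic and fringe count all count the vertices whose fringe tree has
  some property; this lemma moves all of them from paths to the preorder list.\<close>
lemma card_vertices_eq_filter:
  "card {v \<in> vertices T. Q (fringe_tree T v)} = length (filter Q (fringe_trees T))"
proof (induction T)
  case (Node ts)
  let ?V = "\<lambda>i. {v \<in> vertices (ts ! i). Q (fringe_tree (ts ! i) v)}"
  have fin: "finite (?V i)" for i using finite_vertices by simp
  have eq: "{v \<in> vertices (Node ts). Q (fringe_tree (Node ts) v)} =
      (if Q (Node ts) then {[]} else {}) \<union> (\<Union>i<length ts. (#) i ` ?V i)"
    by (auto simp: vertices_Node)
  have "card (\<Union>i<length ts. (#) i ` ?V i) = (\<Sum>i<length ts. card ((#) i ` ?V i))"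
    by (rule card_UN_disjoint) (auto simp: fin)
  also have "\<dots> = (\<Sum>i<length ts. length (filter Q (fringe_trees (ts ! i))))"
    by (intro sum.cong refl) (simp add: card_image Node)
  also have "\<dots> = length (filter Q (concat (map fringe_trees ts)))"
    by (simp add: filter_concat length_concat comp_def sum_list_sum_nth atLeast0LessThan)
  finally have U: "card (\<Union>i<length ts. (#) i ` ?V i) = length (filter Q (concat (map fringe_trees ts)))" .
  show ?case unfolding eq
    by (subst card_Un_disjoint) (auto simp: fin U)
qed

lemma tree_size_eq: "tree_size T = length (preorder_degrees T)"
  using card_vertices_eq_filter[of T "\<lambda>_. True"] by (simp add: tree_size_def preorder_degrees_def)

lemma fringe_count_eq: "fringe_count T' T = length (filter (\<lambda>t. t = T') (fringe_trees T))"
  by (simp add: fringe_count_def card_vertices_eq_filter[of T "\<lambda>t. t = T'"])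

lemma degree_stat_eq: "degree_stat T i = count_list (preorder_degrees T) i"
  using card_vertices_eq_filter[of T "\<lambda>t. length (children t) = i"]
  by (simp add: degree_stat_def degree_at_def preorder_degrees_def count_list_eq_length_filter
      filter_map comp_def eq_commute)

text \<open>A degree word can be parsed in only one way from left to right, because each letter says
  how many subtrees follow. In particular no tree word is a proper prefix of another one.\<close>
lemma preorder_degrees_append_inject:
  "preorder_degrees A @ xs = preorder_degrees B @ ys \<Longrightarrow> A = B \<and> xs = ys"
proof (induction A arbitrary: B xs ys)
  case (Node as)
  have forest: "length us = length bs \<Longrightarrow>
      (\<And>A B xs ys. A \<in> set us \<Longrightarrow> preorder_degrees A @ xs = preorder_degrees B @ ys \<Longrightarrow> A = B \<and> xs = ys) \<Longrightarrow>
      concat (map preorder_degrees us) @ xs = concat (map preorder_degrees bs) @ ys \<Longrightarrow> us = bs \<and> xs = ys"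
    for us bs
  proof (induction us bs rule: list_induct2)
    case (Cons u us b bs)
    have "u = b \<and> concat (map preorder_degrees us) @ xs = concat (map preorder_degrees bs) @ ys"
      by (rule Cons.prems(1)) (use Cons.prems(2) in auto)
    then show ?case using Cons.IH Cons.prems(1) by auto
  qed simp
  obtain bs where B: "B = Node bs" by (cases B)
  have "as = bs \<and> xs = ys"
    by (rule forest) (use Node B in \<open>auto simp: preorder_degrees_Node\<close>)
  then show ?case using B by simp
qed

lemma drop_preorder_degrees:
  "s < length (fringe_trees T) \<Longrightarrow>
    \<exists>rest. drop s (preorder_degrees T) = preorder_degrees (fringe_trees T ! s) @ rest"
proof (induction T arbitrary: s)
  case (Node ts)
  have forest: "(\<And>t s. t \<in> set us \<Longrightarrow> s < length (fringe_trees t) \<Longrightarrow>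
        \<exists>rest. drop s (preorder_degrees t) = preorder_degrees (fringe_trees t ! s) @ rest) \<Longrightarrow>
      s < length (concat (map fringe_trees us)) \<Longrightarrow>
      \<exists>rest. drop s (concat (map preorder_degrees us)) =
        preorder_degrees (concat (map fringe_trees us) ! s) @ rest" for us s
  proof (induction us arbitrary: s)
    case (Cons u us)
    have len: "length (preorder_degrees u) = length (fringe_trees u)"
      by (simp add: preorder_degrees_def)
    show ?case
    proof (cases "s < length (fringe_trees u)")
      case True
      then obtain rest where "drop s (preorder_degrees u) = preorder_degrees (fringe_trees u ! s) @ rest"
        using Cons.prems(1)[of u s] by auto
      then show ?thesis using True len by (auto simp: nth_append)
    next
      case False
      then have "s - length (fringe_trees u) < length (concat (map fringe_trees us))"
        using Cons.prems(2) by auto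
      from Cons.IH[OF _ this] Cons.prems(1) False len show ?thesis by (auto simp: nth_append)
    qed
  qed simp
  show ?case
  proof (cases s)
    case 0
    then show ?thesis by simp
  next
    case (Suc s')
    then show ?thesis using forest[of ts s'] Node by (auto simp: preorder_degrees_Node)
  qed
qed

lemma take_drop_preorder_degrees_iff:
  assumes "s < length (preorder_degrees T)"
  shows "take (length (preorder_degrees T')) (drop s (preorder_degrees T)) = preorder_degrees T'
    \<longleftrightarrow> fringe_trees T ! s = T'"
proof -
  obtain rest where r: "drop s (preorder_degrees T) = preorder_degrees (fringe_trees T ! s) @ rest"
    using drop_preorder_degrees[of s T] assms by (auto simp: preorder_degrees_def)
  show ?thesis
  proof
    assume "take (length (preorder_degrees T')) (drop s (preorder_degrees T)) = preorder_degrees T'"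
    then have "preorder_degrees T' @ drop (length (preorder_degrees T')) (drop s (preorder_degrees T))
        = preorder_degrees (fringe_trees T ! s) @ rest"
      using r by (metis append_take_drop_id)
    then show "fringe_trees T ! s = T'" using preorder_degrees_append_inject by blast
  qed (use r in auto)
qed

text \<open>The subtree at the \<open>s\<close>-th vertex is written contiguously from position \<open>s\<close> on, and by unique
  parsing no other tree word starts there.\<close>
lemma fringe_count_eq_card_factors:
  "fringe_count T' T = card {s. s < length (preorder_degrees T) \<and>
     take (length (preorder_degrees T')) (drop s (preorder_degrees T)) = preorder_degrees T'}"
proof -
  have "fringe_count T' T = card {s. s < length (fringe_trees T) \<and> fringe_trees T ! s = T'}"
    by (simp add: fringe_count_eq length_filter_conv_card)
  also have "{s. s < length (fringe_trees T) \<and> fringe_trees T ! s = T'} =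
     {s. s < length (preorder_degrees T) \<and>
     take (length (preorder_degrees T')) (drop s (preorder_degrees T)) = preorder_degrees T'}"
    using take_drop_preorder_degrees_iff[of _ T T'] by (auto simp: preorder_degrees_def)
  finally show ?thesis .
qed

section \<open>Cycle lemma\<close>

text \<open>Reading a letter \<open>d\<close> completes one pending subtree and opens \<open>d\<close> new ones, so this is the change
  in the number of pending subtrees.\<close>
abbreviation excess :: "nat list \<Rightarrow> int" where
  "excess x \<equiv> (\<Sum>d\<leftarrow>x. int d - 1)"

text \<open>The word of \<open>k\<close> consecutive trees: the number of pending subtrees starts at \<open>k\<close> and reaches \<open>0\<close>
  only at the end.\<close>
definition forest_word :: "nat \<Rightarrow> nat list \<Rightarrow> bool" where
  "forest_word k x \<longleftrightarrow> excess x = - int k \<and> (\<forall>j<length x. - int k < excess (take j x))"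

lemma forest_word_Cons:
  "forest_word k (d # x) \<longleftrightarrow> 0 < k \<and> forest_word (k + d - 1) x"
proof -
  have "(\<forall>j<Suc (length x). - int k < excess (take j (d # x))) \<longleftrightarrow>
      - int k < 0 \<and> (\<forall>j<length x. - int k < int d - 1 + excess (take j x))"
    (is "(\<forall>j<Suc (length x). ?Q j) \<longleftrightarrow> ?R")
  proof -
    have "(\<forall>j<Suc (length x). ?Q j) \<longleftrightarrow> ?Q 0 \<and> (\<forall>j<length x. ?Q (Suc j))"
      using less_Suc_eq_0_disj by auto
    then show ?thesis by simp
  qed
  then have "forest_word k (d # x) \<longleftrightarrow> int d - 1 + excess x = - int k \<and> - int k < 0 \<and>
      (\<forall>j<length x. - int k < int d - 1 + excess (take j x))"
    by (simp add: forest_word_def)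
  moreover have "int d - 1 + e = - int k \<longleftrightarrow> e = - int (k + d - 1)"
    "- int k < int d - 1 + e \<longleftrightarrow> - int (k + d - 1) < e" if "0 < k" for e
    using that by auto
  ultimately show ?thesis by (auto simp: forest_word_def)
qed

lemma forest_word_iff:
  "forest_word k x \<longleftrightarrow> (\<exists>ts. length ts = k \<and> x = concat (map preorder_degrees ts))"
proof (induction x arbitrary: k)
  case Nil
  have "preorder_degrees t \<noteq> []" for t by (cases t) (simp add: preorder_degrees_Node)
  then show ?case by (auto simp: forest_word_def)
next
  case (Cons d x)
  show ?case unfolding forest_word_Cons Cons.IH
  proof (intro iffI; elim conjE exE)
    fix ts :: "plane_tree list"
    assume "0 < k" and ts: "length ts = k + d - 1" and x: "x = concat (map preorder_degrees ts)"
    have "concat (map preorder_degrees ts) =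
        concat (map preorder_degrees (take d ts)) @ concat (map preorder_degrees (drop d ts))"
      by (metis append_take_drop_id concat_append map_append)
    moreover have "length (take d ts) = d" "length (drop d ts) = k - 1" using ts \<open>0 < k\<close> by auto
    ultimately show "\<exists>us. length us = k \<and> d # x = concat (map preorder_degrees us)"
      using \<open>0 < k\<close> x
      by (intro exI[of _ "Node (take d ts) # drop d ts"]) (simp add: preorder_degrees_Node)
  next
    fix us assume k: "length us = k" and eq: "d # x = concat (map preorder_degrees us)"
    then obtain u us' where us: "us = u # us'" by (cases us) auto
    obtain ts where u: "u = Node ts" by (cases u)
    show "0 < k \<and> (\<exists>ts. length ts = k + d - 1 \<and> x = concat (map preorder_degrees ts))"
      using eq us u k by (intro conjI exI[of _ "ts @ us'"]) (auto simp add: preorder_degrees_Node)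
  qed
qed

lemma forest_word_1_iff: "forest_word 1 x \<longleftrightarrow> x \<in> range preorder_degrees"
proof -
  have "(\<exists>ts :: plane_tree list. length ts = 1 \<and> x = concat (map preorder_degrees ts)) \<longleftrightarrow> (\<exists>t. x = preorder_degrees t)"
    by (auto simp: length_Suc_conv intro: exI[of _ "[t]" for t])
  then show ?thesis unfolding forest_word_iff by auto
qed

lemma excess_append: "excess (x @ y) = excess x + excess y" by simp

lemma excess_take_drop: "excess (take j (drop r x)) = excess (take (r + j) x) - excess (take r x)"
  by (simp add: take_add)

text \<open>The prefix sums of a rotation are those of the word, shifted and with \<open>1\<close> subtracted from
  the part that was moved to the end. They stay nonnegative before the end exactly when the rotation starts at the first
  minimum among those of the proper prefixes.\<close>
lemma forest_word_rotate_iff: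
  assumes "excess x = -1" "r < length x"
  shows "forest_word 1 (rotate r x) \<longleftrightarrow>
    (\<forall>q<length x. excess (take r x) \<le> excess (take q x)) \<and>
    (\<forall>q<r. excess (take r x) < excess (take q x))"
proof -
  let ?N = "length x" and ?S = "\<lambda>q. excess (take q x)"
  have rot: "rotate r x = drop r x @ take r x" using assms by (simp add: rotate_drop_take)
  have tot: "excess (drop r x) = -1 - ?S r"
    using assms(1) excess_append[of "take r x" "drop r x"] by simp
  have early: "excess (take j (rotate r x)) = ?S (r + j) - ?S r" if "r + j < ?N" for j
    using that by (simp add: rot excess_take_drop)
  have late: "excess (take j (rotate r x)) = ?S (r + j - ?N) - ?S r - 1" if "?N \<le> r + j" "j < ?N" for j
  proof -
    have "j - (?N - r) = r + j - ?N" "min r (r + j - ?N) = r + j - ?N" "length (drop r x) \<le> j"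
      using that assms(2) by auto
    then have "take j (rotate r x) = drop r x @ take (r + j - ?N) x"
      by (simp add: rot min.commute)
    then show ?thesis using tot by simp
  qed
  have "excess (rotate r x) = -1" using tot by (simp add: rot)
  then have "forest_word 1 (rotate r x) \<longleftrightarrow> (\<forall>j<?N. 0 \<le> excess (take j (rotate r x)))"
    by (auto simp: forest_word_def)
  also have "\<dots> \<longleftrightarrow> (\<forall>q<?N. ?S r \<le> ?S q) \<and> (\<forall>q<r. ?S r < ?S q)"
  proof safe
    fix q assume nn: "\<forall>j<?N. 0 \<le> excess (take j (rotate r x))"
    show less: "?S r < ?S q" if "q < r"
      using nn[rule_format, of "q + ?N - r"] late[of "q + ?N - r"] that assms(2) by simp
    show "?S r \<le> ?S q" if "q < ?N"
      using nn[rule_format, of "q - r"] early[of "q - r"] less that by (cases "q < r") auto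
  next
    fix j assume "\<forall>q<?N. ?S r \<le> ?S q" "\<forall>q<r. ?S r < ?S q" "j < ?N"
    then show "0 \<le> excess (take j (rotate r x))"
      using early[of j] late[of j] assms(2) by (cases "r + j < ?N") (auto simp: less_diff_conv2)
  qed
  finally show ?thesis .
qed

theorem cycle_lemma:
  assumes "excess x = -1"
  shows "\<exists>!r. r < length x \<and> rotate r x \<in> range preorder_degrees"
proof -
  let ?S = "\<lambda>q. excess (take q x)"
  define P where "P r \<longleftrightarrow> r < length x \<and> (\<forall>q<length x. ?S r \<le> ?S q)" for r
  have "x \<noteq> []" using assms by auto
  then obtain r0 where "P r0"
    using ex_min_if_finite[of "?S ` {..<length x}"] unfolding P_def by (auto simp: not_less)
  define r where "r = (LEAST r. P r)"
  have r: "P r" "\<And>q. q < r \<Longrightarrow> \<not> P q"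
    unfolding r_def by (rule LeastI[of P, OF \<open>P r0\<close>], rule not_less_Least)
  have first: "?S r < ?S q" if "q < r" for q
    using r(1) r(2)[OF that] that by (fastforce simp: P_def)
  show ?thesis
  proof (rule ex1I[of _ r])
    show "r < length x \<and> rotate r x \<in> range preorder_degrees"
      using r(1) first forest_word_rotate_iff[OF assms, of r] unfolding P_def forest_word_1_iff by blast
  next
    fix r' assume r': "r' < length x \<and> rotate r' x \<in> range preorder_degrees"
    then have "P r'" "\<forall>q<r'. ?S r' < ?S q"
      using forest_word_rotate_iff[OF assms, of r'] unfolding P_def forest_word_1_iff by blast+
    moreover from this(1) have "\<not> r' < r" using r(2) by blast
    ultimately show "r' = r" using r(1) unfolding P_def by (metis linorder_neqE_nat not_less)
  qed
qed

lemma excess_preorder_degrees: "excess (preorder_degrees T) = -1"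
  using forest_word_1_iff[of "preorder_degrees T"] by (auto simp: forest_word_def)

lemma excess_take_preorder_degrees:
  "j < length (preorder_degrees T) \<Longrightarrow> 0 \<le> excess (take j (preorder_degrees T))"
  using forest_word_1_iff[of "preorder_degrees T"] by (auto simp: forest_word_def)

lemma preorder_degrees_inject: "preorder_degrees A = preorder_degrees B \<Longrightarrow> A = B"
  using preorder_degrees_append_inject[of A "[]" B "[]"] by simp

lemma preorder_degrees_nonempty: "preorder_degrees T \<noteq> []"
  by (cases T) (simp add: preorder_degrees_Node)

text \<open>A proper prefix of a tree word has excess at least \<open>0\<close>, hence a nonempty suffix has excess at
  most \<open>-1\<close>.\<close>
lemma preorder_degrees_border_free:
  assumes "0 < s" "s < length (preorder_degrees T)"
  shows "drop s (preorder_degrees T) \<noteq> take (length (preorder_degrees T) - s) (preorder_degrees T)"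
proof
  let ?w = "preorder_degrees T"
  assume "drop s ?w = take (length ?w - s) ?w"
  then have "excess (drop s ?w) \<ge> 0"
    using excess_take_preorder_degrees[of "length ?w - s" T] assms by simp
  moreover have "excess (take s ?w) \<ge> 0" using excess_take_preorder_degrees assms by blast
  ultimately show False
    using excess_preorder_degrees[of T] excess_append[of "take s ?w" "drop s ?w"] by simp
qed

section \<open>Random trees and random permutations\<close>
definition cyclic_occurrences :: "'a list \<Rightarrow> 'a list \<Rightarrow> nat" where
  "cyclic_occurrences w x = card {s. s < length x \<and> take (length w) (rotate s x) = w}"

lemma cyclic_occurrences_rotate: "cyclic_occurrences w (rotate r x) = cyclic_occurrences w x"
proof (cases "x = []")
  case False
  let ?N = "length x"
  have N: "?N > 0" using False by simp
  let ?A = "{s. s < ?N \<and> take (length w) (rotate s (rotate r x)) = w}"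
  let ?B = "{s. s < ?N \<and> take (length w) (rotate s x) = w}"
  let ?f = "\<lambda>s. (s + r) mod ?N"
  have rot: "rotate s (rotate r x) = rotate ((s + r) mod ?N) x" for s
    by (simp add: rotate_rotate flip: rotate_conv_mod)
  have inv: "((s + r) mod ?N + (?N - r mod ?N)) mod ?N = s" if "s < ?N" for s
  proof -
    have "((s + r) mod ?N + (?N - r mod ?N)) mod ?N = (s + r mod ?N + (?N - r mod ?N)) mod ?N"
      by (metis mod_add_left_eq mod_add_right_eq)
    also have "s + r mod ?N + (?N - r mod ?N) = s + ?N"
      using N mod_less_divisor[of ?N r] by linarith
    finally show ?thesis using that by simp
  qed
  have inv': "((s + (?N - r mod ?N)) mod ?N + r) mod ?N = s" if "s < ?N" for s
  proof -
    have "((s + (?N - r mod ?N)) mod ?N + r) mod ?N = (s + (?N - r mod ?N) + r mod ?N) mod ?N"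
      by (metis mod_add_left_eq mod_add_right_eq)
    also have "s + (?N - r mod ?N) + r mod ?N = s + ?N"
      using N mod_less_divisor[of ?N r] by linarith
    finally show ?thesis using that by simp
  qed
  have "bij_betw ?f ?A ?B"
    by (rule bij_betw_byWitness[where f' = "\<lambda>s. (s + (?N - r mod ?N)) mod ?N"])
       (use inv inv' N rot in auto)
  then show ?thesis by (simp add: cyclic_occurrences_def bij_betw_same_card)
qed simp

text \<open>An occurrence that wraps around would make a proper suffix of the word of \<open>T\<close>, of negative
  excess, a proper prefix of the word of \<open>T'\<close>, of nonnegative excess.\<close>
lemma cyclic_occurrences_preorder_degrees:
  assumes "length (preorder_degrees T') \<le> length (preorder_degrees T)"
  shows "cyclic_occurrences (preorder_degrees T') (preorder_degrees T) = fringe_count T' T"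
proof -
  let ?w = "preorder_degrees T'" and ?x = "preorder_degrees T"
  have "take (length ?w) (rotate s ?x) = ?w \<longleftrightarrow> take (length ?w) (drop s ?x) = ?w" if s: "s < length ?x" for s
  proof (cases "s + length ?w \<le> length ?x")
    case True
    then show ?thesis using s by (simp add: rotate_drop_take)
  next
    case False
    have "take (length ?w) (rotate s ?x) \<noteq> ?w"
    proof
      assume "take (length ?w) (rotate s ?x) = ?w"
      moreover have "take (length ?x - s) (rotate s ?x) = drop s ?x"
        using s by (simp add: rotate_drop_take)
      moreover have lt: "length ?x - s < length ?w" using False s by linarith
      ultimately have "drop s ?x = take (length ?x - s) ?w"
        by (metis min.absorb1 less_imp_le take_take)
      then have "0 \<le> excess (drop s ?x)"
        using excess_take_preorder_degrees[OF lt] by simp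
      moreover have "0 \<le> excess (take s ?x)" using excess_take_preorder_degrees[OF s] .
      ultimately show False
        using excess_preorder_degrees[of T] excess_append[of "take s ?x" "drop s ?x"] by simp
    qed
    moreover have "take (length ?w) (drop s ?x) \<noteq> ?w"
    proof
      assume "take (length ?w) (drop s ?x) = ?w"
      then have "length (take (length ?w) (drop s ?x)) = length ?w" by simp
      then show False using False s by simp
    qed
    ultimately show ?thesis by simp
  qed
  then show ?thesis unfolding cyclic_occurrences_def fringe_count_eq_card_factors by metis
qed

lemma mem_trees_of_stat_iff:
  assumes "\<And>i. count_list x i = n i"
  shows "T \<in> trees_of_stat n \<longleftrightarrow> mset (preorder_degrees T) = mset x"
  using assms by (auto simp: trees_of_stat_def multiset_eq_iff fun_eq_iff degree_stat_eq simp flip: count_mset)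

lemma finite_mset_eq: "finite {y. mset y = mset x}"
proof (rule finite_subset)
  show "{y. mset y = mset x} \<subseteq> {y. set y \<subseteq> set x \<and> length y = length x}"
    by (auto dest: mset_eq_setD mset_eq_length)
qed (simp add: finite_lists_length_eq)

lemma excess_mset_cong: "mset y = mset x \<Longrightarrow> excess y = excess x"
  by (metis mset_map sum_mset_sum_list)

lemma mset_rotate: "mset (rotate r y) = mset y"
  by (metis rotate_drop_take mset_append union_commute append_take_drop_id)

lemma bij_betw_rotated_trees:
  assumes cnt: "\<And>i. count_list x i = n i" and ex: "excess x = -1"
  shows "bij_betw (\<lambda>(T, r). rotate r (preorder_degrees T)) (trees_of_stat n \<times> {..<length x}) {y. mset y = mset x}"
proof -
  let ?N = "length x" and ?f = "\<lambda>(T, r). rotate r (preorder_degrees T)"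
  have len: "length (preorder_degrees T) = ?N" if "T \<in> trees_of_stat n" for T
    using that mem_trees_of_stat_iff[OF cnt] mset_eq_length by blast
  have cyc: "\<exists>!r. r < ?N \<and> rotate r y \<in> range preorder_degrees" if "mset y = mset x" for y
    using cycle_lemma[of y] excess_mset_cong[OF that] ex mset_eq_length[OF that] by simp
  have unrot: "rotate ((?N - r) mod ?N) (rotate r y) = y" if "length y = ?N" "r < ?N" for r y
    using that by (cases "r = 0") (simp_all add: rotate_rotate rotate_id)
  have N: "0 < ?N" using ex by (cases x) auto
  have "inj_on ?f (trees_of_stat n \<times> {..<?N})"
  proof (rule inj_onI, clarify)
    fix A r B s
    assume A: "A \<in> trees_of_stat n" "r < ?N" and B: "B \<in> trees_of_stat n" "s < ?N"
      and eq: "rotate r (preorder_degrees A) = rotate s (preorder_degrees B)"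
    let ?y = "rotate r (preorder_degrees A)"
    have "mset ?y = mset x" using A mem_trees_of_stat_iff[OF cnt] by (simp add: mset_rotate)
    moreover have bA: "rotate ((?N - r) mod ?N) ?y = preorder_degrees A"
      using unrot len A by blast
    moreover have bB: "rotate ((?N - s) mod ?N) ?y = preorder_degrees B"
      using unrot len B unfolding eq by blast
    ultimately have rs: "(?N - r) mod ?N = (?N - s) mod ?N"
      using cyc[of ?y] N by (metis mod_less_divisor rangeI)
    then have "r = s" using A(2) B(2)
      by (cases "r = 0"; cases "s = 0") auto
    then show "A = B \<and> r = s" using bA bB by (simp add: preorder_degrees_inject)
  qed
  moreover have "?f ` (trees_of_stat n \<times> {..<?N}) = {y. mset y = mset x}"
  proof safe
    fix T r assume "T \<in> trees_of_stat n"
    then show "mset (rotate r (preorder_degrees T)) = mset x"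
      using mem_trees_of_stat_iff[OF cnt] by (simp add: mset_rotate)
  next
    fix y assume y: "mset y = mset x"
    then obtain r T where r: "r < ?N" "rotate r y = preorder_degrees T" using cyc[OF y] by blast
    have "T \<in> trees_of_stat n" using y mem_trees_of_stat_iff[OF cnt] by (simp add: mset_rotate flip: r(2))
    moreover have "y = rotate ((?N - r) mod ?N) (preorder_degrees T)"
      using unrot[of y r] r y mset_eq_length by metis
    ultimately show "y \<in> ?f ` (trees_of_stat n \<times> {..<?N})" using N by force
  qed
  ultimately show ?thesis by (simp add: bij_betw_def)
qed

text \<open>All arrangements of a word come from the same number of permutations, because the
  permutations that yield a given arrangement form a coset of those that fix the word.\<close>
lemma sum_permute_list:
  obtains c where "\<And>h :: 'a list \<Rightarrow> 'b::field_char_0. (\<Sum>\<sigma> | \<sigma> permutes {..<length x}. h (permute_list \<sigma> x)) = of_nat c * (\<Sum>y | mset y = mset x. h y)"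
proof
  let ?S = "{\<sigma>. \<sigma> permutes {..<length x}}"
  define c where "c = card {\<sigma> \<in> ?S. permute_list \<sigma> x = x}"
  fix h :: "'a list \<Rightarrow> 'b"
  have fib: "card {\<sigma> \<in> ?S. permute_list \<sigma> x = y} = c" if y: "mset y = mset x" for y
  proof -
    obtain \<pi> where \<pi>: "\<pi> permutes {..<length x}" "permute_list \<pi> x = y"
      using mset_eq_permutation[OF y] by blast
    have "permute_list (\<sigma> \<circ> inv \<pi>) x = x" if "\<sigma> permutes {..<length x}" "permute_list \<sigma> x = y" for \<sigma>
    proof -
      have "permute_list (\<sigma> \<circ> inv \<pi>) x = permute_list (inv \<pi>) (permute_list \<pi> x)"
        using that \<pi> by (simp add: permute_list_compose permutes_inv)
      also have "\<dots> = permute_list (\<pi> \<circ> inv \<pi>) x"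
        using \<pi> by (simp add: permute_list_compose permutes_inv)
      finally show ?thesis using permutes_inv_o(1)[OF \<pi>(1)] by simp
    qed
    then have "bij_betw (\<lambda>\<sigma>. \<sigma> \<circ> \<pi>) {\<sigma> \<in> ?S. permute_list \<sigma> x = x} {\<sigma> \<in> ?S. permute_list \<sigma> x = y}"
      using \<pi> permutes_inv_o[OF \<pi>(1)]
      by (intro bij_betw_byWitness[where f' = "\<lambda>\<sigma>. \<sigma> \<circ> inv \<pi>"])
         (auto simp: o_assoc[symmetric] permutes_compose permutes_inv permute_list_compose)
    then show ?thesis unfolding c_def by (simp add: bij_betw_same_card)
  qed
  have "(\<Sum>\<sigma>\<in>?S. h (permute_list \<sigma> x)) =
      (\<Sum>y | mset y = mset x. \<Sum>\<sigma> | \<sigma> \<in> ?S \<and> permute_list \<sigma> x = y. h (permute_list \<sigma> x))"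
    by (intro sum.group[symmetric]) (auto simp: finite_permutations finite_mset_eq)
  also have "\<dots> = (\<Sum>y | mset y = mset x. of_nat c * h y)"
    proof (intro sum.cong refl)
    fix y assume "y \<in> {y. mset y = mset x}"
    then have "card {\<sigma>. \<sigma> permutes {..<length x} \<and> permute_list \<sigma> x = y} = c" using fib[of y] by simp
    then show "(\<Sum>\<sigma> | \<sigma> \<in> ?S \<and> permute_list \<sigma> x = y. h (permute_list \<sigma> x)) = of_nat c * h y" by simp
  qed
  finally show "(\<Sum>\<sigma>\<in>?S. h (permute_list \<sigma> x)) = of_nat c * (\<Sum>y | mset y = mset x. h y)"
    by (simp add: sum_distrib_left)
qed

lemma finite_nonempty_trees_of_stat:
  assumes cnt: "\<And>i. count_list x i = n i" and ex: "excess x = -1"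
  shows "finite (trees_of_stat n)" "trees_of_stat n \<noteq> {}"
proof -
  note b = bij_betw_rotated_trees[OF assms]
  have N: "{..<length x} \<noteq> {}" using ex by (cases x) auto
  show "trees_of_stat n \<noteq> {}" using b by (auto simp: bij_betw_def)
  have "finite (trees_of_stat n \<times> {..<length x})"
    using bij_betw_finite[OF b] finite_mset_eq by blast
  then show "finite (trees_of_stat n)" using N finite_cartesian_productD1 by blast
qed

theorem average_trees_eq_average_permutations:
  fixes h :: "nat \<Rightarrow> 'b::field_char_0"
  assumes cnt: "\<And>i. count_list x i = n i" and ex: "excess x = -1"
    and len: "length (preorder_degrees T') \<le> length x"
  shows "(\<Sum>T\<in>trees_of_stat n. h (fringe_count T' T)) / of_nat (card (trees_of_stat n)) =
    (\<Sum>\<sigma> | \<sigma> permutes {..<length x}. h (cyclic_occurrences (preorder_degrees T') (permute_list \<sigma> x)))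
      / fact (length x)"
proof -
  let ?N = "length x" and ?w = "preorder_degrees T'"
  obtain c where c: "\<And>h :: nat list \<Rightarrow> 'b. (\<Sum>\<sigma> | \<sigma> permutes {..<?N}. h (permute_list \<sigma> x)) =
      of_nat c * (\<Sum>y | mset y = mset x. h y)"
    using sum_permute_list by blast
  have N: "0 < ?N" using ex by (cases x) auto
  have key: "(\<Sum>\<sigma> | \<sigma> permutes {..<?N}. g (cyclic_occurrences ?w (permute_list \<sigma> x))) =
      of_nat (c * ?N) * (\<Sum>T\<in>trees_of_stat n. g (fringe_count T' T))" for g :: "nat \<Rightarrow> 'b"
  proof -
    have "(\<Sum>y | mset y = mset x. g (cyclic_occurrences ?w y)) =
       (\<Sum>(T, r)\<in>trees_of_stat n \<times> {..<?N}. g (cyclic_occurrences ?w (rotate r (preorder_degrees T))))"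
      using sum.reindex_bij_betw[OF bij_betw_rotated_trees[OF cnt ex],
          of "\<lambda>y. g (cyclic_occurrences ?w y)"] by (simp add: case_prod_beta')
    also have "\<dots> = (\<Sum>(T, r)\<in>trees_of_stat n \<times> {..<?N}. g (fringe_count T' T))"
    proof (intro sum.cong refl, clarify)
      fix T r assume "T \<in> trees_of_stat n"
      then have "length (preorder_degrees T) = ?N"
        using mem_trees_of_stat_iff[OF cnt] mset_eq_length by blast
      then show "g (cyclic_occurrences ?w (rotate r (preorder_degrees T))) = g (fringe_count T' T)"
        using len by (simp add: cyclic_occurrences_rotate cyclic_occurrences_preorder_degrees)
    qed
    also have "\<dots> = of_nat ?N * (\<Sum>T\<in>trees_of_stat n. g (fringe_count T' T))"
      by (simp add: sum.cartesian_product[symmetric] sum_distrib_left)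
    finally show ?thesis using c[of "\<lambda>y. g (cyclic_occurrences ?w y)"] by (simp add: mult.assoc)
  qed
  \<comment> \<open>taking \<open>h = 1\<close> determines the constant\<close>
  from key[of "\<lambda>_. 1"] have one: "(fact ?N :: 'b) = of_nat (c * ?N) * of_nat (card (trees_of_stat n))"
    by (simp add: card_permutations)
  have "(fact ?N :: 'b) \<noteq> 0" by simp
  then have "(of_nat (c * ?N) :: 'b) \<noteq> 0" unfolding one by force
  then show ?thesis unfolding key one by (simp add: mult_divide_mult_cancel_left)
qed

section \<open>Fixing an occurrence by a coupling\<close>

text \<open>Any \<open>k\<close> distinct positions can be brought to \<open>0, \<dots>, k - 1\<close> without moving any other position
  from \<open>m\<close> on: bring them there one after the other by transpositions.\<close>
lemma ex_permutes_filling: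
  assumes "inj_on p {..<k}" "p ` {..<k} \<subseteq> {..<N}" "k \<le> m" "m \<le> (N::nat)"
  shows "\<exists>h. h permutes {..<N} \<and> (\<forall>j<k. h (p j) = j) \<and> (\<forall>q. m \<le> q \<and> q \<notin> p ` {..<k} \<longrightarrow> h q = q)"
  using assms
proof (induction k)
  case 0
  then show ?case by (intro exI[of _ id] conjI permutes_id) auto
next
  case (Suc k)
  then obtain h where h: "h permutes {..<N}" "\<And>j. j < k \<Longrightarrow> h (p j) = j"
      "\<And>q. m \<le> q \<Longrightarrow> q \<notin> p ` {..<k} \<Longrightarrow> h q = q"
    by (auto simp: lessThan_Suc)
  let ?h = "Transposition.transpose k (h (p k)) \<circ> h"
  have pk: "p k < N" using Suc.prems by auto
  have inj: "h x = h y \<longleftrightarrow> x = y" for x y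
    using permutes_inj[OF h(1)] by (auto dest: injD)
  have new: "p k \<noteq> p j" if "j < k" for j
    using inj_onD[OF Suc.prems(1), of k j] that by auto
  have "h (p k) < N" using permutes_in_image[OF h(1), of "p k"] pk by simp
  then have "?h permutes {..<N}"
    using h(1) Suc.prems by (intro permutes_compose permutes_swap_id) auto
  moreover have "?h (p j) = j" if "j < Suc k" for j
  proof (cases "j = k")
    case False
    then have "j < k" using that by simp
    moreover from this have "j \<noteq> h (p k)" using h(2)[of j] new[of j] inj by metis
    ultimately show ?thesis using h(2) by (simp add: Transposition.transpose_def)
  qed simp
  moreover have "?h q = q" if "m \<le> q" "q \<notin> p ` {..<Suc k}" for q
  proof -
    have "h q = q" using h(3) that by (auto simp: lessThan_Suc)
    moreover have "q \<noteq> k" using that Suc.prems by auto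
    moreover have "q \<noteq> h (p k)" using inj[of q "p k"] that \<open>h q = q\<close> by auto
    ultimately show ?thesis by (simp add: Transposition.transpose_def)
  qed
  ultimately show ?case by blast
qed

text \<open>The vertices \<open>0, \<dots>, N - 1\<close> have degrees \<open>d\<close> and are placed on a cycle of \<open>N\<close> positions by a
  permutation \<open>\<sigma>\<close>, position \<open>q\<close> receiving the vertex \<open>\<sigma> q\<close>; one looks for the word \<open>w\<close> of length \<open>m\<close>.
  Probabilities and means over uniform permutations are written as plain sums over all permutations.\<close>
locale random_arrangement =
  fixes N m :: nat and d w :: "nat \<Rightarrow> nat"
  assumes m_pos: "0 < m" and m_le: "m \<le> N"
    and border_free: "\<And>s. 0 < s \<Longrightarrow> s < m \<Longrightarrow> \<exists>j < m - s. w (s + j) \<noteq> w j"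
begin

definition perms :: "(nat \<Rightarrow> nat) set" where
  "perms = {\<sigma>. \<sigma> permutes {..<N}}"

definition occ :: "(nat \<Rightarrow> nat) \<Rightarrow> nat \<Rightarrow> bool" where
  "occ \<sigma> s \<longleftrightarrow> (\<forall>j<m. d (\<sigma> ((s + j) mod N)) = w j)"

definition count :: "(nat \<Rightarrow> nat) \<Rightarrow> nat" where
  "count \<sigma> = (\<Sum>s<N. of_bool (occ \<sigma> s))"

text \<open>The starts of the windows that neither meet the positions below \<open>m\<close> nor wrap around.\<close>
definition inner_starts :: "nat set" where
  "inner_starts = {s. m \<le> s \<and> s + m \<le> N}"

definition inner_count :: "(nat \<Rightarrow> nat) \<Rightarrow> nat" where
  "inner_count \<sigma> = (\<Sum>s\<in>inner_starts. of_bool (occ \<sigma> s))"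

text \<open>Injections of \<open>{..<m}\<close> into \<open>{..<N}\<close>. They serve both as lists of positions (written \<open>p\<close>) and as
  lists of vertices (written \<open>a\<close>).\<close>
definition placements :: "(nat \<Rightarrow> nat) set" where
  "placements = {p \<in> {..<m} \<rightarrow>\<^sub>E {..<N}. inj_on p {..<m}}"

text \<open>The permutations that have the vertices \<open>a\<close> in the first \<open>m\<close> positions.\<close>
definition extending :: "(nat \<Rightarrow> nat) \<Rightarrow> (nat \<Rightarrow> nat) set" where
  "extending a = {\<sigma> \<in> perms. \<forall>j<m. \<sigma> j = a j}"

definition spelling :: "(nat \<Rightarrow> nat) set" where
  "spelling = {a \<in> placements. \<forall>j<m. d (a j) = w j}"

text \<open>A permutation of positions that takes the positions \<open>p\<close> to the initial block and moves as little
  as possible elsewhere. If \<open>\<sigma>\<close> has the vertices \<open>a\<close> in the initial block, then \<open>\<sigma> \<circ> filling p\<close> has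
  them at the positions \<open>p\<close>.\<close>
definition filling :: "(nat \<Rightarrow> nat) \<Rightarrow> nat \<Rightarrow> nat" where
  "filling p = (SOME h. h permutes {..<N} \<and> (\<forall>j<m. h (p j) = j) \<and>
     (\<forall>q. m \<le> q \<and> q \<notin> p ` {..<m} \<longrightarrow> h q = q))"

lemma N_pos: "0 < N" using m_pos m_le by simp

lemma inner_starts_subset: "inner_starts \<subseteq> {..<N}" using m_pos by (auto simp: inner_starts_def)

lemma finite_inner_starts [simp]: "finite inner_starts" using inner_starts_subset finite_subset by blast

lemma finite_perms [simp]: "finite perms" by (simp add: perms_def finite_permutations)

lemma card_perms: "card perms = fact N" by (simp add: perms_def card_permutations)

lemma finite_placements [simp]: "finite placements"
  unfolding placements_def by (rule finite_subset[of _ "{..<m} \<rightarrow>\<^sub>E {..<N}"]) (auto intro: finite_PiE)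

lemma finite_spelling [simp]: "finite spelling" by (simp add: spelling_def)

lemma finite_extending [simp]: "finite (extending a)" by (simp add: extending_def)

lemma filling:
  assumes "p \<in> placements"
  shows "filling p permutes {..<N}" "\<And>j. j < m \<Longrightarrow> filling p (p j) = j"
    "\<And>q. m \<le> q \<Longrightarrow> q \<notin> p ` {..<m} \<Longrightarrow> filling p q = q"
proof -
  have "\<exists>h. h permutes {..<N} \<and> (\<forall>j<m. h (p j) = j) \<and> (\<forall>q. m \<le> q \<and> q \<notin> p ` {..<m} \<longrightarrow> h q = q)"
    using assms m_le by (intro ex_permutes_filling) (auto simp: placements_def)
  from someI_ex[OF this] show "filling p permutes {..<N}" "\<And>j. j < m \<Longrightarrow> filling p (p j) = j"
    "\<And>q. m \<le> q \<Longrightarrow> q \<notin> p ` {..<m} \<Longrightarrow> filling p q = q"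
    unfolding filling_def by blast+
qed

text \<open>This is the coupling: a uniform permutation is the same as a uniform permutation with the
  vertices \<open>a\<close> in front together with an independent uniform list of positions to which these
  vertices are moved. The positions are recovered from the result as those of the vertices \<open>a\<close>.\<close>
lemma bij_betw_perms_split:
  assumes a: "a \<in> placements"
  shows "bij_betw (\<lambda>(p, \<sigma>). \<sigma> \<circ> filling p) (placements \<times> extending a) perms"
proof (rule bij_betw_byWitness[where f' = "\<lambda>\<sigma>. (restrict (inv \<sigma> \<circ> a) {..<m},
      \<sigma> \<circ> inv (filling (restrict (inv \<sigma> \<circ> a) {..<m})))"])
  let ?p = "\<lambda>\<sigma>. restrict (inv \<sigma> \<circ> a) {..<m}"
  let ?g = "\<lambda>\<sigma>. (?p \<sigma>, \<sigma> \<circ> inv (filling (?p \<sigma>)))"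
  have pl: "?p \<sigma> \<in> placements" if "\<sigma> \<in> perms" for \<sigma>
  proof -
    have inv: "inv \<sigma> permutes {..<N}" using that by (simp add: perms_def permutes_inv)
    have "a j < N" if "j < m" for j using a that by (auto simp: placements_def)
    then have "inv \<sigma> (a j) < N" if "j < m" for j
      using permutes_in_image[OF inv, of "a j"] that by simp
    moreover have "inj_on (?p \<sigma>) {..<m}"
      using a comp_inj_on[of a "{..<m}" "inv \<sigma>"] permutes_inj_on[OF inv]
      by (simp add: placements_def inj_on_restrict_eq)
    ultimately show ?thesis by (auto simp: placements_def)
  qed
  show "\<forall>x\<in>placements \<times> extending a. ?g ((\<lambda>(p, \<sigma>). \<sigma> \<circ> filling p) x) = x"
  proof
    fix x assume "x \<in> placements \<times> extending a"
    then obtain p \<sigma> where x: "x = (p, \<sigma>)" and p: "p \<in> placements" and \<sigma>: "\<sigma> \<in> extending a"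
      by blast
    note h = filling[OF p]
    have per: "\<sigma> \<circ> filling p permutes {..<N}"
      using h(1) \<sigma> by (auto simp: extending_def perms_def intro: permutes_compose)
    have "inv (\<sigma> \<circ> filling p) (a j) = p j" if "j < m" for j
      using permutes_inverses(2)[OF per, of "p j"] h(2)[OF that] \<sigma> that by (simp add: extending_def)
    then have "?p (\<sigma> \<circ> filling p) = p"
      using p by (auto simp: placements_def fun_eq_iff restrict_def PiE_def extensional_def)
    then show "?g ((\<lambda>(p, \<sigma>). \<sigma> \<circ> filling p) x) = x"
      using permutes_inv_o(1)[OF h(1)] by (simp add: x o_assoc[symmetric])
  qed
  show "\<forall>\<sigma>\<in>perms. (\<lambda>(p, \<sigma>). \<sigma> \<circ> filling p) (?g \<sigma>) = \<sigma>"
  proof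
    fix \<sigma> assume "\<sigma> \<in> perms"
    from permutes_inv_o(2)[OF filling(1)[OF pl[OF this]]]
    show "(\<lambda>(p, \<sigma>). \<sigma> \<circ> filling p) (?g \<sigma>) = \<sigma>" by (simp add: o_assoc[symmetric])
  qed
  show "(\<lambda>(p, \<sigma>). \<sigma> \<circ> filling p) ` (placements \<times> extending a) \<subseteq> perms"
    using filling(1) by (auto simp: extending_def perms_def intro!: permutes_compose)
  show "?g ` perms \<subseteq> placements \<times> extending a"
  proof
    fix x assume "x \<in> ?g ` perms"
    then obtain \<sigma> where \<sigma>: "\<sigma> \<in> perms" and x: "x = ?g \<sigma>" by blast
    note h = filling[OF pl[OF \<sigma>]]
    have "(\<sigma> \<circ> inv (filling (?p \<sigma>))) j = a j" if "j < m" for j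
    proof -
      have "inv (filling (?p \<sigma>)) j = ?p \<sigma> j"
        using permutes_inverses(2)[OF h(1), of "?p \<sigma> j"] h(2)[OF that] by simp
      then show ?thesis using that \<sigma> permutes_inverses(1)[of \<sigma> "{..<N}" "a j"] by (simp add: perms_def)
    qed
    then have "\<sigma> \<circ> inv (filling (?p \<sigma>)) \<in> extending a"
      using \<sigma> h(1) by (auto simp: extending_def perms_def intro!: permutes_compose permutes_inv)
    then show "x \<in> placements \<times> extending a"
      using pl[OF \<sigma>] x by blast
  qed
qed

lemma sum_perms_split:
  assumes "a \<in> placements"
  shows "(\<Sum>\<sigma>\<in>perms. F \<sigma>) = (\<Sum>p\<in>placements. \<Sum>\<sigma>\<in>extending a. F (\<sigma> \<circ> filling p))"
  using sum.reindex_bij_betw[OF bij_betw_perms_split[OF assms], of F]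
  by (simp add: sum.cartesian_product case_prod_beta')

lemma card_extending:
  assumes "a \<in> placements"
  shows "card placements * card (extending a) = fact N"
  using sum_perms_split[OF assms, of "\<lambda>_. 1 :: nat"] by (simp add: card_perms)

text \<open>Each entry of a uniform injection is uniform: swapping two values permutes the injections.\<close>
lemma card_placements_at:
  assumes "j < m" "q < N"
  shows "N * card {p \<in> placements. p j = q} = card placements"
proof -
  have le: "card {p \<in> placements. p j = q} = card {p \<in> placements. p j = q'}" if "q < N" "q' < N" for q q'
  proof -
    let ?f = "\<lambda>p. restrict (Transposition.transpose q q' \<circ> p) {..<m}"
    have maps: "?f p \<in> placements" if "p \<in> placements" for p
    proof -
      have "Transposition.transpose q q' (p i) < N" if "i < m" for i
        using \<open>p \<in> placements\<close> that \<open>q < N\<close> \<open>q' < N\<close>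
        by (auto simp: placements_def Transposition.transpose_def)
      moreover have "inj_on (?f p) {..<m}"
        using that comp_inj_on[of p "{..<m}" "Transposition.transpose q q'"] inj_on_transpose
        by (simp add: placements_def inj_on_restrict_eq)
      ultimately show ?thesis by (auto simp: placements_def)
    qed
    have invo: "?f (?f p) = p" if "p \<in> placements" for p
      using that by (auto simp: placements_def fun_eq_iff PiE_def extensional_def)
    have "bij_betw ?f {p \<in> placements. p j = q} {p \<in> placements. p j = q'}"
    proof (rule bij_betw_byWitness[where f' = ?f])
      show "?f ` {p \<in> placements. p j = q} \<subseteq> {p \<in> placements. p j = q'}"
        "?f ` {p \<in> placements. p j = q'} \<subseteq> {p \<in> placements. p j = q}"
        using maps \<open>j < m\<close> by auto
    qed (use invo in auto)
    then show ?thesis by (rule bij_betw_same_card)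
  qed
  have "card placements = card (\<Union>x<N. {p \<in> placements. p j = x})"
    using assms by (intro arg_cong[where f = card]) (auto simp: placements_def)
  also have "\<dots> = (\<Sum>x<N. card {p \<in> placements. p j = x})"
    by (rule card_UN_disjoint) auto
  also have "\<dots> = (\<Sum>x<N. card {p \<in> placements. p j = q})"
    by (intro sum.cong refl le) (use assms in auto)
  finally show ?thesis by simp
qed

definition rotation :: "nat \<Rightarrow> nat \<Rightarrow> nat" where
  "rotation r q = (if q < N then (r + q) mod N else q)"

lemma rotation: "rotation r permutes {..<N}"
proof (rule bij_imp_permutes)
  have "inj_on (rotation r) {..<N}"
  proof (rule inj_onI)
    fix x y assume xy: "x \<in> {..<N}" "y \<in> {..<N}" "rotation r x = rotation r y"
    then have "int (r + x) mod int N = int (r + y) mod int N"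
      by (metis lessThan_iff rotation_def zmod_int)
    then have "int x mod int N = int y mod int N" by (simp add: mod_eq_dvd_iff)
    then show "x = y" using xy(1,2) by simp
  qed
  moreover have "rotation r ` {..<N} \<subseteq> {..<N}" using N_pos by (auto simp: rotation_def)
  ultimately show "bij_betw (rotation r) {..<N} {..<N}"
    unfolding bij_betw_def using endo_inj_surj[OF finite_lessThan] by blast
qed (simp add: rotation_def)

lemma occ_mod: "occ \<sigma> (s mod N) = occ \<sigma> s"
  by (simp add: occ_def mod_add_left_eq)

lemma occ_rotation: "occ (\<sigma> \<circ> rotation r) s = occ \<sigma> (r + s)"
  using N_pos by (simp add: occ_def rotation_def mod_add_right_eq add.assoc)

lemma count_rotation: "count (\<sigma> \<circ> rotation r) = count \<sigma>"
proof -
  have "count (\<sigma> \<circ> rotation r) = (\<Sum>s<N. of_bool (occ \<sigma> (rotation r s)))"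
    by (simp add: count_def occ_rotation rotation_def occ_mod)
  also have "\<dots> = count \<sigma>"
    unfolding count_def using sum.permute[OF rotation[of r], of "\<lambda>s. of_bool (occ \<sigma> s)"] unfolding comp_def by (rule sym)
  finally show ?thesis .
qed

lemma sum_perms_rotation: "(\<Sum>\<sigma>\<in>perms. F (\<sigma> \<circ> rotation r)) = (\<Sum>\<sigma>\<in>perms. F \<sigma>)"
proof -
  note h = rotation[of r]
  have "bij_betw (\<lambda>\<sigma>. \<sigma> \<circ> rotation r) perms perms"
    by (rule bij_betw_byWitness[where f' = "\<lambda>\<sigma>. \<sigma> \<circ> inv (rotation r)"])
       (auto simp: perms_def o_assoc[symmetric] permutes_inv_o[OF h] intro!: permutes_compose permutes_inv h)
  then show ?thesis by (rule sum.reindex_bij_betw)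
qed

lemma sum_occ_eq:
  fixes g :: "nat \<Rightarrow> 'b::comm_semiring_1"
  shows "(\<Sum>\<sigma>\<in>perms. of_bool (occ \<sigma> s) * g (count \<sigma>)) = (\<Sum>\<sigma>\<in>perms. of_bool (occ \<sigma> 0) * g (count \<sigma>))"
  using sum_perms_rotation[of "\<lambda>\<sigma>. of_bool (occ \<sigma> 0) * g (count \<sigma>)" s]
  by (simp add: count_rotation occ_rotation)

text \<open>Size biasing: by rotation invariance, weighting by the number of occurrences amounts to
  requiring an occurrence at position \<open>0\<close>.\<close>
lemma sum_count_times:
  fixes g :: "nat \<Rightarrow> 'b::comm_semiring_1"
  shows "(\<Sum>\<sigma>\<in>perms. of_nat (count \<sigma>) * g (count \<sigma>)) =
    of_nat N * (\<Sum>\<sigma>\<in>perms. of_bool (occ \<sigma> 0) * g (count \<sigma>))"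
proof -
  have "(\<Sum>\<sigma>\<in>perms. of_nat (count \<sigma>) * g (count \<sigma>)) =
      (\<Sum>\<sigma>\<in>perms. \<Sum>s<N. of_bool (occ \<sigma> s) * g (count \<sigma>))"
    by (intro sum.cong refl) (simp add: sum_distrib_right[symmetric], simp add: count_def)
  also have "\<dots> = (\<Sum>s<N. \<Sum>\<sigma>\<in>perms. of_bool (occ \<sigma> s) * g (count \<sigma>))" by (rule sum.swap)
  also have "\<dots> = of_nat N * (\<Sum>\<sigma>\<in>perms. of_bool (occ \<sigma> 0) * g (count \<sigma>))"
    by (subst sum_occ_eq) simp
  finally show ?thesis .
qed

lemma sum_occ_0: "(\<Sum>\<sigma>\<in>perms. of_bool (occ \<sigma> 0) * F \<sigma>) = (\<Sum>a\<in>spelling. \<Sum>\<sigma>\<in>extending a. (F \<sigma> :: 'b::comm_semiring_1))"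
proof -
  have eq: "occ \<sigma> 0 \<longleftrightarrow> (\<forall>j<m. d (\<sigma> j) = w j)" for \<sigma>
    using m_le by (auto simp: occ_def)
  let ?S = "{\<sigma> \<in> perms. occ \<sigma> 0}"
  have fibre: "{\<sigma> \<in> ?S. restrict \<sigma> {..<m} = a} = extending a" if "a \<in> spelling" for a
    using that by (auto simp: extending_def eq spelling_def placements_def fun_eq_iff restrict_def PiE_def extensional_def)
  have img: "restrict \<sigma> {..<m} \<in> spelling" if "\<sigma> \<in> ?S" for \<sigma>
  proof -
    have \<sigma>: "\<sigma> permutes {..<N}" using that by (simp add: perms_def)
    then have "\<sigma> j < N" if "j < m" for j using that m_le permutes_in_image[OF \<sigma>, of j] by simp
    moreover have "inj_on \<sigma> {..<m}" using permutes_inj_on[OF \<sigma>] .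
    ultimately show ?thesis using that by (auto simp: spelling_def placements_def eq)
  qed
  have "(\<Sum>\<sigma>\<in>perms. of_bool (occ \<sigma> 0) * F \<sigma>) = (\<Sum>\<sigma>\<in>?S. F \<sigma>)"
    by (intro sum.mono_neutral_cong_right) auto
  also have "\<dots> = (\<Sum>a\<in>spelling. \<Sum>\<sigma> | \<sigma> \<in> ?S \<and> restrict \<sigma> {..<m} = a. F \<sigma>)"
    by (rule sum.group[symmetric]) (use img in auto)
  also have "\<dots> = (\<Sum>a\<in>spelling. \<Sum>\<sigma>\<in>extending a. F \<sigma>)"
    using fibre by (intro sum.cong) auto
  finally show ?thesis .
qed

text \<open>An occurrence overlapping the one at position \<open>0\<close>, from either side, would give \<open>w\<close> a border.\<close>
lemma count_extending:
  assumes a: "a \<in> spelling" and \<sigma>: "\<sigma> \<in> extending a"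
  shows "count \<sigma> = Suc (inner_count \<sigma>)"
proof -
  have o0: "d (\<sigma> j) = w j" if "j < m" for j
    using a \<sigma> that by (auto simp: spelling_def extending_def)
  have "\<not> occ \<sigma> s" if s: "s < N" "s \<notin> inner_starts" "s \<noteq> 0" for s
  proof
    assume occ: "occ \<sigma> s"
    show False
    proof (cases "s < m")
      case True
      then obtain j where j: "j < m - s" "w (s + j) \<noteq> w j" using border_free s by auto
      have "d (\<sigma> (s + j)) = w j"
        using occ[unfolded occ_def, rule_format, of j] j m_le by simp
      then show False using o0[of "s + j"] j by simp
    next
      case False
      then have sN: "N < s + m" using s(2) by (auto simp: inner_starts_def)
      have "0 < N - s" "N - s < m" using s sN by auto
      from border_free[OF this] obtain j where j: "j < m - (N - s)" "w (N - s + j) \<noteq> w j"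
        by blast
      have "d (\<sigma> ((s + (N - s + j)) mod N)) = w (N - s + j)"
        using occ j sN unfolding occ_def by simp
      moreover have "(s + (N - s + j)) mod N = j" using s j m_le by simp
      ultimately show False using o0[of j] j by simp
    qed
  qed
  moreover have "occ \<sigma> 0" using o0 m_le by (auto simp: occ_def)
  moreover have "0 \<notin> inner_starts" using m_pos by (simp add: inner_starts_def)
  ultimately have "count \<sigma> = (\<Sum>s\<in>insert 0 inner_starts. of_bool (occ \<sigma> s))"
    unfolding count_def using inner_starts_subset N_pos by (intro sum.mono_neutral_right) auto
  then show ?thesis using \<open>occ \<sigma> 0\<close> \<open>0 \<notin> inner_starts\<close> by (simp add: inner_count_def)
qed

text \<open>The number of occurrences of the word that use the vertex \<open>c\<close>.\<close>
definition hits :: "nat \<Rightarrow> (nat \<Rightarrow> nat) \<Rightarrow> nat" where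
  "hits c \<sigma> = (\<Sum>s<N. of_bool (occ \<sigma> s \<and> (\<exists>i<m. \<sigma> ((s + i) mod N) = c)))"

definition stock :: "nat \<Rightarrow> nat" where
  "stock k = card {c. c < N \<and> d c = k}"

definition demand :: "nat \<Rightarrow> nat" where
  "demand k = card {i. i < m \<and> w i = k}"

text \<open>In terms of letters this is \<open>\<Sum> (demand k)\<^sup>2 / stock k\<close>, see \<open>load_eq\<close>. It is the expected number of occurrences
  that use one of the vertices of a fixed occurrence, counted with multiplicity and divided by the mean
  number of occurrences.\<close>
definition load :: real where
  "load = (\<Sum>j<m. real (demand (w j)) / real (stock (w j)))"

lemma sum_hits_cong:
  assumes c: "c < N" "c' < N" "d c' = d c"
  shows "(\<Sum>\<sigma>\<in>perms. hits c' \<sigma>) = (\<Sum>\<sigma>\<in>perms. hits c \<sigma>)"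
proof -
  let ?t = "Transposition.transpose c c'"
  have t: "?t permutes {..<N}" using c by (intro permutes_swap_id) auto
  have dt: "d (?t x) = d x" for x using c(3) by (simp add: Transposition.transpose_def)
  have "bij_betw (\<lambda>\<sigma>. ?t \<circ> \<sigma>) perms perms"
    by (rule bij_betw_byWitness[where f' = "\<lambda>\<sigma>. ?t \<circ> \<sigma>"])
       (auto simp: perms_def o_assoc intro!: permutes_compose t)
  then have "(\<Sum>\<sigma>\<in>perms. hits c' \<sigma>) = (\<Sum>\<sigma>\<in>perms. hits c' (?t \<circ> \<sigma>))"
    by (rule sum.reindex_bij_betw[symmetric])
  also have "\<dots> = (\<Sum>\<sigma>\<in>perms. hits c \<sigma>)"
  proof -
    have "?t x = c' \<longleftrightarrow> x = c" for x by (auto simp: Transposition.transpose_def)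
    then show ?thesis by (simp only: hits_def occ_def comp_def dt)
  qed
  finally show ?thesis .
qed

text \<open>Vertices of equal degree are exchangeable, and each occurrence uses exactly \<open>demand k\<close> vertices of
  degree \<open>k\<close>; so each of the \<open>stock k\<close> vertices of degree \<open>k\<close> is used equally often.\<close>
lemma stock_times_sum_hits:
  assumes c: "c < N"
  shows "stock (d c) * (\<Sum>\<sigma>\<in>perms. hits c \<sigma>) = demand (d c) * (\<Sum>\<sigma>\<in>perms. count \<sigma>)"
proof -
  let ?T = "{c'. c' < N \<and> d c' = d c}"
  \<comment> \<open>within one occurrence, the vertices of degree \<open>d c\<close> correspond to the letters \<open>d c\<close> of \<open>w\<close>\<close>
  have window: "(\<Sum>c'\<in>?T. of_bool (occ \<sigma> s \<and> (\<exists>i<m. \<sigma> ((s + i) mod N) = c'))) =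
      demand (d c) * of_bool (occ \<sigma> s)" if \<sigma>: "\<sigma> \<in> perms" for \<sigma> s
  proof (cases "occ \<sigma> s")
    case True
    let ?f = "\<lambda>i. \<sigma> (rotation s i)"
    have f: "?f i = \<sigma> ((s + i) mod N)" if "i < m" for i using that m_le by (simp add: rotation_def)
    have per: "\<sigma> permutes {..<N}" using \<sigma> by (simp add: perms_def)
    have "inj ?f" using inj_compose[OF permutes_inj[OF per] permutes_inj[OF rotation]] by (simp add: comp_def)
    have "?f i < N" if "i < m" for i
      using permutes_in_image[OF per, of "rotation s i"] permutes_in_image[OF rotation, of s i] that m_le by simp
    then have "?T \<inter> {c'. \<exists>i<m. \<sigma> ((s + i) mod N) = c'} = ?f ` {i. i < m \<and> w i = d c}"
      using True f by (auto simp: occ_def image_iff)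
    then have "card (?T \<inter> {c'. \<exists>i<m. \<sigma> ((s + i) mod N) = c'}) = demand (d c)"
      using \<open>inj ?f\<close> by (simp add: demand_def card_image inj_on_subset)
    then show ?thesis using True by simp
  qed simp
  have "stock (d c) * (\<Sum>\<sigma>\<in>perms. hits c \<sigma>) = (\<Sum>c'\<in>?T. \<Sum>\<sigma>\<in>perms. hits c' \<sigma>)"
    using sum_hits_cong[OF c] by (simp add: stock_def)
  also have "\<dots> = (\<Sum>\<sigma>\<in>perms. \<Sum>c'\<in>?T. hits c' \<sigma>)" by (rule sum.swap)
  also have "\<dots> = (\<Sum>\<sigma>\<in>perms. demand (d c) * count \<sigma>)"
  proof (intro sum.cong refl)
    fix \<sigma> assume "\<sigma> \<in> perms"
    have "(\<Sum>c'\<in>?T. hits c' \<sigma>) = (\<Sum>s<N. \<Sum>c'\<in>?T. of_bool (occ \<sigma> s \<and> (\<exists>i<m. \<sigma> ((s + i) mod N) = c')))"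
      unfolding hits_def by (rule sum.swap)
    also have "\<dots> = (\<Sum>s<N. demand (d c) * of_bool (occ \<sigma> s))"
      by (simp only: window[OF \<open>\<sigma> \<in> perms\<close>])
    finally show "(\<Sum>c'\<in>?T. hits c' \<sigma>) = demand (d c) * count \<sigma>"
      by (simp only: count_def sum_distrib_left)
  qed
  finally show ?thesis by (simp add: sum_distrib_left)
qed

text \<open>Occurrences in the interior windows that are hit by the chosen positions \<open>p\<close>, counted with
  multiplicity.\<close>
definition near :: "(nat \<Rightarrow> nat) \<Rightarrow> (nat \<Rightarrow> nat) \<Rightarrow> nat" where
  "near p \<sigma> = (\<Sum>j<m. \<Sum>s\<in>inner_starts. of_bool (occ \<sigma> s \<and> p j \<in> {s..<s + m}))"

definition outer_count :: "(nat \<Rightarrow> nat) \<Rightarrow> nat" where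
  "outer_count \<sigma> = (\<Sum>s\<in>{..<N} - inner_starts. of_bool (occ \<sigma> s))"

lemma count_eq: "count \<sigma> = inner_count \<sigma> + outer_count \<sigma>"
  unfolding count_def inner_count_def outer_count_def
  using sum.subset_diff[OF inner_starts_subset finite_lessThan] by (metis add.commute)

text \<open>An interior window that contains none of the chosen positions keeps its content.\<close>
lemma occ_filling:
  assumes p: "p \<in> placements" and s: "s \<in> inner_starts" and away: "\<And>j. j < m \<Longrightarrow> p j \<notin> {s..<s + m}"
  shows "occ (\<sigma> \<circ> filling p) s \<longleftrightarrow> occ \<sigma> s"
proof -
  have "filling p ((s + i) mod N) = (s + i) mod N" if "i < m" for i
  proof -
    have "(s + i) mod N = s + i" "m \<le> s + i" using s that by (auto simp: inner_starts_def)
    moreover have "s + i \<notin> p ` {..<m}" using away that by (metis (no_types, lifting) atLeastLessThan_iff imageE le_add1 lessThan_iff nat_add_left_cancel_less)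
    ultimately show ?thesis using filling(3)[OF p] by metis
  qed
  then show ?thesis by (simp add: occ_def)
qed

text \<open>An occurrence in an interior window after the move either was there before or its window
  contains a position of \<open>p\<close>, in which case it uses one of the vertices \<open>a\<close>.\<close>
lemma count_filling_le:
  assumes p: "p \<in> placements" and \<sigma>: "\<sigma> \<in> extending a"
  shows "count (\<sigma> \<circ> filling p) \<le>
    inner_count \<sigma> + outer_count (\<sigma> \<circ> filling p) + (\<Sum>j<m. hits (a j) (\<sigma> \<circ> filling p))"
proof -
  let ?\<tau> = "\<sigma> \<circ> filling p"
  let ?H = "\<lambda>j s. occ ?\<tau> s \<and> (\<exists>i<m. ?\<tau> ((s + i) mod N) = a j)"
  have "of_bool (occ ?\<tau> s) \<le> of_bool (occ \<sigma> s) + (\<Sum>j<m. of_bool (?H j s) :: nat)" if s: "s \<in> inner_starts" for s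
  proof (cases "occ ?\<tau> s \<and> \<not> occ \<sigma> s")
    case True
    then obtain j where j: "j < m" "p j \<in> {s..<s + m}" using occ_filling[OF p s] by blast
    have "?\<tau> (p j) = a j" using filling(2)[OF p j(1)] \<sigma> j(1) by (simp add: extending_def)
    moreover have "(s + (p j - s)) mod N = p j" "p j - s < m" using j s by (auto simp: inner_starts_def)
    ultimately have "?H j s" using True by metis
    then have "(1::nat) = of_bool (?H j s)" by simp
    also have "\<dots> \<le> (\<Sum>j<m. of_bool (?H j s))" using j by (intro member_le_sum) auto
    finally show ?thesis by (rule order_trans[OF _ trans_le_add2, rotated]) simp
  qed auto
  then have "inner_count ?\<tau> \<le> (\<Sum>s\<in>inner_starts. of_bool (occ \<sigma> s) + (\<Sum>j<m. of_bool (?H j s)))"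
    unfolding inner_count_def by (rule sum_mono)
  also have "\<dots> = inner_count \<sigma> + (\<Sum>s\<in>inner_starts. \<Sum>j<m. of_bool (?H j s))"
    by (simp only: sum.distrib inner_count_def)
  also have "(\<Sum>s\<in>inner_starts. \<Sum>j<m. of_bool (?H j s) :: nat) \<le> (\<Sum>s<N. \<Sum>j<m. of_bool (?H j s))"
    using inner_starts_subset by (intro sum_mono2) auto
  also have "\<dots> = (\<Sum>j<m. hits (a j) ?\<tau>)" unfolding hits_def by (rule sum.swap)
  finally show ?thesis unfolding count_eq[of ?\<tau>] by linarith
qed

lemma inner_count_le_filling:
  assumes p: "p \<in> placements"
  shows "inner_count \<sigma> \<le> count (\<sigma> \<circ> filling p) + near p \<sigma>"
proof -
  let ?\<tau> = "\<sigma> \<circ> filling p"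
  let ?H = "\<lambda>j s. occ \<sigma> s \<and> p j \<in> {s..<s + m}"
  have "of_bool (occ \<sigma> s) \<le> of_bool (occ ?\<tau> s) + (\<Sum>j<m. of_bool (?H j s) :: nat)" if s: "s \<in> inner_starts" for s
  proof (cases "occ \<sigma> s \<and> \<not> occ ?\<tau> s")
    case True
    then obtain j where j: "j < m" "p j \<in> {s..<s + m}" using occ_filling[OF p s] by blast
    then have "(1::nat) = of_bool (?H j s)" using True by simp
    also have "\<dots> \<le> (\<Sum>j<m. of_bool (?H j s))" using j by (intro member_le_sum) auto
    finally show ?thesis by (rule order_trans[OF _ trans_le_add2, rotated]) simp
  qed auto
  then have "inner_count \<sigma> \<le> (\<Sum>s\<in>inner_starts. of_bool (occ ?\<tau> s) + (\<Sum>j<m. of_bool (?H j s)))"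
    unfolding inner_count_def by (rule sum_mono)
  also have "\<dots> = inner_count ?\<tau> + (\<Sum>s\<in>inner_starts. \<Sum>j<m. of_bool (?H j s))"
    by (simp only: sum.distrib inner_count_def)
  also have "(\<Sum>s\<in>inner_starts. \<Sum>j<m. of_bool (?H j s)) = near p \<sigma>"
    unfolding near_def by (rule sum.swap)
  finally show ?thesis unfolding count_eq[of ?\<tau>] by linarith
qed

lemma sum_outer_count_le: "N * (\<Sum>\<sigma>\<in>perms. outer_count \<sigma>) \<le> 2 * m * (\<Sum>\<sigma>\<in>perms. count \<sigma>)"
proof -
  let ?o = "\<Sum>\<sigma>\<in>perms. of_bool (occ \<sigma> 0) :: nat"
  have "(\<Sum>\<sigma>\<in>perms. outer_count \<sigma>) = (\<Sum>s\<in>{..<N} - inner_starts. \<Sum>\<sigma>\<in>perms. of_bool (occ \<sigma> s))"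
    unfolding outer_count_def by (rule sum.swap)
  also have "\<dots> = card ({..<N} - inner_starts) * ?o"
  proof -
    have "(\<Sum>\<sigma>\<in>perms. of_bool (occ \<sigma> s)) = ?o" for s
      using sum_occ_eq[of s "\<lambda>_. 1::nat"] by (simp only: mult_1_right)
    then have "(\<Sum>s\<in>{..<N} - inner_starts. \<Sum>\<sigma>\<in>perms. of_bool (occ \<sigma> s)) = (\<Sum>s\<in>{..<N} - inner_starts. ?o)"
      by (rule sum.cong[OF refl])
    then show ?thesis by (simp only: sum_constant of_nat_id)
  qed
  also have "\<dots> \<le> 2 * m * ?o"
  proof (rule mult_right_mono)
    have "{..<N} - inner_starts \<subseteq> {..<m} \<union> {N - m..<N}" by (auto simp: inner_starts_def)
    then have "card ({..<N} - inner_starts) \<le> card ({..<m} \<union> {N - m..<N})" by (intro card_mono) auto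
    also have "\<dots> \<le> card {..<m} + card {N - m..<N}" by (rule card_Un_le)
    finally show "card ({..<N} - inner_starts) \<le> 2 * m" using m_le by simp
  qed simp
  finally have "N * (\<Sum>\<sigma>\<in>perms. outer_count \<sigma>) \<le> 2 * m * (N * ?o)"
    by (metis mult.left_commute mult_le_mono2)
  also have "N * ?o = (\<Sum>\<sigma>\<in>perms. count \<sigma>)"
    using sum_count_times[of "\<lambda>_. 1::nat"] by (simp del: sum_of_bool_eq)
  finally show ?thesis .
qed

text \<open>The positions are chosen independently of the permutation, and each of them falls into a given
  window with probability \<open>m / N\<close>.\<close>
lemma sum_near: "N * (\<Sum>p\<in>placements. near p \<sigma>) = m * m * card placements * inner_count \<sigma>"
proof -
  have window: "N * (\<Sum>p\<in>placements. of_bool (p j \<in> {s..<s + m})) = m * card placements"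
    if j: "j < m" and s: "s \<in> inner_starts" for j s
  proof -
    have "(\<Sum>p\<in>placements. of_bool (p j \<in> {s..<s + m})) =
        (\<Sum>p\<in>placements. \<Sum>q\<in>{s..<s + m}. of_bool (p j = q) :: nat)"
      by (intro sum.cong refl) (simp add: of_bool_def)
    also have "\<dots> = (\<Sum>q\<in>{s..<s + m}. \<Sum>p\<in>placements. of_bool (p j = q))" by (rule sum.swap)
    also have "\<dots> = (\<Sum>q\<in>{s..<s + m}. card {p \<in> placements. p j = q})"
      by (simp add: Int_def)
    finally have "N * (\<Sum>p\<in>placements. of_bool (p j \<in> {s..<s + m})) =
        (\<Sum>q\<in>{s..<s + m}. N * card {p \<in> placements. p j = q})"
      by (simp only: sum_distrib_left)
    also have "\<dots> = (\<Sum>q\<in>{s..<s + m}. card placements)"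
      using s by (intro sum.cong refl card_placements_at[OF j]) (auto simp: inner_starts_def)
    finally show ?thesis by simp
  qed
  have "(\<Sum>p\<in>placements. near p \<sigma>) =
      (\<Sum>j<m. \<Sum>s\<in>inner_starts. \<Sum>p\<in>placements. of_bool (occ \<sigma> s) * of_bool (p j \<in> {s..<s + m}))"
    unfolding near_def of_bool_conj
    by (subst sum.swap, intro sum.cong refl, rule sum.swap)
  then have "N * (\<Sum>p\<in>placements. near p \<sigma>) =
      (\<Sum>j<m. \<Sum>s\<in>inner_starts. of_bool (occ \<sigma> s) * (N * (\<Sum>p\<in>placements. of_bool (p j \<in> {s..<s + m}))))"
    by (simp only: sum_distrib_left mult.left_commute)
  also have "\<dots> = (\<Sum>j<m. \<Sum>s\<in>inner_starts. of_bool (occ \<sigma> s) * (m * card placements))"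
    by (intro sum.cong refl arg_cong2[where f = "(*)"] window) auto
  also have "\<dots> = m * (m * card placements * inner_count \<sigma>)"
    by (simp only: sum_constant inner_count_def sum_distrib_left sum_distrib_right card_lessThan of_nat_id mult_ac)
  finally show ?thesis by (simp add: mult.assoc)
qed

lemma load_eq: "load = (\<Sum>k\<in>w ` {..<m}. (real (demand k))\<^sup>2 / real (stock k))"
proof -
  have "load = (\<Sum>k\<in>w ` {..<m}. \<Sum>j | j \<in> {..<m} \<and> w j = k. real (demand (w j)) / real (stock (w j)))"
    unfolding load_def by (rule sum.group[symmetric]) auto
  also have "\<dots> = (\<Sum>k\<in>w ` {..<m}. real (demand k) * (real (demand k) / real (stock k)))"
    by (intro sum.cong refl) (simp add: demand_def)
  finally show ?thesis by (simp add: power2_eq_square)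
qed

lemma sum_demand: "(\<Sum>k\<in>w ` {..<m}. demand k) = m"
proof -
  have "(\<Sum>k\<in>w ` {..<m}. demand k) = (\<Sum>k\<in>w ` {..<m}. \<Sum>j | j \<in> {..<m} \<and> w j = k. 1)"
    by (simp add: demand_def)
  also have "\<dots> = (\<Sum>j<m. 1)" by (rule sum.group) auto
  finally show ?thesis by simp
qed

lemma sum_stock_le: "(\<Sum>k\<in>w ` {..<m}. stock k) \<le> N"
proof -
  have "(\<Sum>k\<in>w ` {..<m}. stock k) = card (\<Union>k\<in>w ` {..<m}. {c. c < N \<and> d c = k})"
    unfolding stock_def by (rule card_UN_disjoint[symmetric]) auto
  also have "\<dots> \<le> card {..<N}" by (rule card_mono) auto
  finally show ?thesis by simp
qed

text \<open>The Cauchy-Schwarz inequality for \<open>m = \<Sum> demand k\<close> and \<open>\<Sum> stock k \<le> N\<close>.\<close>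
lemma load_ge:
  assumes "\<And>j. j < m \<Longrightarrow> 0 < stock (w j)"
  shows "(real m)\<^sup>2 / real N \<le> load"
proof -
  let ?c = "real m / real N" and ?D = "w ` {..<m}"
  have N: "real N > 0" using N_pos by simp
  \<comment> \<open>linearise each square at the proportional value \<open>demand k = ?c * stock k\<close>\<close>
  have "2 * ?c * real (demand k) - ?c\<^sup>2 * real (stock k) \<le> (real (demand k))\<^sup>2 / real (stock k)"
    if k: "k \<in> ?D" for k
  proof -
    have n: "real (stock k) > 0" using assms k by auto
    have "0 \<le> (real (demand k) - ?c * real (stock k))\<^sup>2 / real (stock k)" using n by simp
    also have "\<dots> = (real (demand k))\<^sup>2 / real (stock k) - (2 * ?c * real (demand k) - ?c\<^sup>2 * real (stock k))"
      using n N by (simp add: field_simps power2_eq_square)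
    finally show ?thesis by simp
  qed
  then have "(\<Sum>k\<in>?D. 2 * ?c * real (demand k) - ?c\<^sup>2 * real (stock k)) \<le> load"
    unfolding load_eq by (rule sum_mono)
  moreover have "(\<Sum>k\<in>?D. 2 * ?c * real (demand k) - ?c\<^sup>2 * real (stock k)) =
      2 * ?c * real (\<Sum>k\<in>?D. demand k) - ?c\<^sup>2 * real (\<Sum>k\<in>?D. stock k)"
    by (simp add: sum_subtractf sum_distrib_left)
  moreover have "?c\<^sup>2 * real (\<Sum>k\<in>?D. stock k) \<le> ?c\<^sup>2 * real N"
    using sum_stock_le by (intro mult_left_mono) (simp_all flip: of_nat_sum)
  moreover have "2 * ?c * real m - ?c\<^sup>2 * real N = (real m)\<^sup>2 / real N"
    using N by (simp add: field_simps power2_eq_square)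
  ultimately show ?thesis by (simp only: sum_demand)
qed

definition total :: real where
  "total = (\<Sum>\<sigma>\<in>perms. real (count \<sigma>))"

lemma stock_pos:
  assumes "a \<in> spelling" "j < m"
  shows "0 < stock (w j)"
proof -
  have "a j \<in> {c. c < N \<and> d c = w j}" using assms by (auto simp: spelling_def placements_def)
  then show ?thesis unfolding stock_def by (auto simp: card_gt_0_iff)
qed

text \<open>The \<open>L\<^sup>1\<close> distance of \<open>count\<close> and \<open>inner_count\<close> under the coupling, up to the factor \<open>fact N\<close>. There
  are three contributions: windows that meet the block or wrap around (at most \<open>2 * m\<close> of them), occurrences
  created by moving the vertices \<open>a\<close>, and occurrences destroyed by this. The last one is proportional to
  the mean of \<open>inner_count\<close>, which the coupling itself bounds by twice the mean of \<open>count\<close>.\<close>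
lemma coupling_bound:
  assumes a: "a \<in> spelling" and small: "load \<le> 1 / 2"
  shows "(\<Sum>p\<in>placements. \<Sum>\<sigma>\<in>extending a. \<bar>real (count (\<sigma> \<circ> filling p)) - real (inner_count \<sigma>)\<bar>)
     \<le> 5 * load * total"
proof -
  have ap: "a \<in> placements" using a by (simp add: spelling_def)
  let ?S = "\<lambda>f :: _ \<Rightarrow> _ \<Rightarrow> real. \<Sum>p\<in>placements. \<Sum>\<sigma>\<in>extending a. f p \<sigma>"
  define I where "I = (\<Sum>p\<in>placements. \<Sum>\<sigma>\<in>extending a. real (inner_count \<sigma>))"
  define R where "R = (\<Sum>p\<in>placements. \<Sum>\<sigma>\<in>extending a. real (near p \<sigma>))"
  define O' where "O' = (\<Sum>\<sigma>\<in>perms. real (outer_count \<sigma>))"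
  define H where "H = (\<Sum>\<sigma>\<in>perms. \<Sum>j<m. real (hits (a j) \<sigma>))"
  have N: "real N > 0" and m: "real m \<ge> 1" using N_pos m_pos by auto
  have T: "total \<ge> 0" by (simp add: total_def sum_nonneg)
  have I0: "I \<ge> 0" by (simp add: I_def sum_nonneg)
  have m2: "(real m)\<^sup>2 / real N \<le> load" using load_ge stock_pos[OF a] by blast
  have load0: "0 \<le> load" using m2 N by (meson divide_nonneg_pos order_trans zero_le_power2)
  have O_le: "O' \<le> 2 * load * total"
  proof -
    have "real (N * (\<Sum>\<sigma>\<in>perms. outer_count \<sigma>)) \<le> real (2 * m * (\<Sum>\<sigma>\<in>perms. count \<sigma>))"
      using sum_outer_count_le by (simp only: of_nat_le_iff)
    then have "real N * O' \<le> 2 * real m * total"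
      by (simp only: O'_def total_def of_nat_mult of_nat_sum of_nat_numeral)
    then have "O' \<le> 2 * (real m / real N) * total" using N by (simp add: field_simps)
    also have "\<dots> \<le> 2 * ((real m)\<^sup>2 / real N) * total"
      using m N T by (intro mult_right_mono mult_left_mono divide_right_mono) (auto simp: power2_eq_square)
    also have "\<dots> \<le> 2 * load * total" using m2 T by (intro mult_right_mono) auto
    finally show ?thesis .
  qed
  have H_eq: "H = load * total"
  proof -
    have "(\<Sum>\<sigma>\<in>perms. real (hits (a j) \<sigma>)) = real (demand (w j)) / real (stock (w j)) * total" if "j < m" for j
    proof -
      have aj: "a j < N" "d (a j) = w j" using a that by (auto simp: spelling_def placements_def)
      have "real (stock (w j)) * (\<Sum>\<sigma>\<in>perms. real (hits (a j) \<sigma>)) = real (demand (w j)) * total"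
        using arg_cong[OF stock_times_sum_hits[OF aj(1)], of real]
        by (simp only: aj(2) total_def of_nat_mult of_nat_sum)
      then show ?thesis using stock_pos[OF a that] by (simp add: field_simps)
    qed
    moreover have "H = (\<Sum>j<m. \<Sum>\<sigma>\<in>perms. real (hits (a j) \<sigma>))" unfolding H_def by (rule sum.swap)
    ultimately show ?thesis by (simp add: load_def sum_distrib_right)
  qed
  have R_eq: "R = (real m)\<^sup>2 / real N * I"
  proof -
    have "real N * (\<Sum>p\<in>placements. real (near p \<sigma>)) = real m * real m * real (card placements) * real (inner_count \<sigma>)" for \<sigma>
      using arg_cong[OF sum_near[of \<sigma>], of real] by (simp only: of_nat_mult of_nat_sum)
    then have "(\<Sum>\<sigma>\<in>extending a. real N * (\<Sum>p\<in>placements. real (near p \<sigma>))) = (real m)\<^sup>2 * I"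
      by (simp add: I_def sum_distrib_left power2_eq_square mult.assoc)
    moreover have "R = (\<Sum>\<sigma>\<in>extending a. \<Sum>p\<in>placements. real (near p \<sigma>))"
      unfolding R_def by (rule sum.swap)
    ultimately have "real N * R = (real m)\<^sup>2 * I" by (simp add: sum_distrib_left)
    then show ?thesis using N by (simp add: field_simps)
  qed
  have R_le: "R \<le> load * I" unfolding R_eq using m2 I0 by (rule mult_right_mono)
  have split: "(\<Sum>\<sigma>\<in>perms. F \<sigma>) = ?S (\<lambda>p \<sigma>. F (\<sigma> \<circ> filling p))" for F :: "_ \<Rightarrow> real"
    by (rule sum_perms_split[OF ap])
  have below: "real (inner_count \<sigma>) \<le> real (count (\<sigma> \<circ> filling p)) + real (near p \<sigma>)"
    if "p \<in> placements" for p \<sigma>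
    using inner_count_le_filling[OF that, of \<sigma>] by (simp only: of_nat_le_iff flip: of_nat_add)
  \<comment> \<open>\<open>I \<le> total + load * I\<close> and \<open>load \<le> 1 / 2\<close> bound \<open>I\<close>\<close>
  have "I \<le> ?S (\<lambda>p \<sigma>. real (count (\<sigma> \<circ> filling p)) + real (near p \<sigma>))"
    unfolding I_def by (intro sum_mono below)
  also have "\<dots> = total + R" by (simp add: sum.distrib total_def split R_def)
  finally have "I \<le> total + load * I" using R_le by simp
  moreover have "load * I \<le> 1 / 2 * I" using small I0 by (rule mult_right_mono)
  ultimately have I_le: "I \<le> 2 * total" by simp
  have "\<bar>real (count (\<sigma> \<circ> filling p)) - real (inner_count \<sigma>)\<bar> \<le>
      real (outer_count (\<sigma> \<circ> filling p)) + (\<Sum>j<m. real (hits (a j) (\<sigma> \<circ> filling p))) + real (near p \<sigma>)"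
    if p: "p \<in> placements" and \<sigma>: "\<sigma> \<in> extending a" for p \<sigma>
  proof -
    have "real (count (\<sigma> \<circ> filling p)) \<le> real (inner_count \<sigma>) + real (outer_count (\<sigma> \<circ> filling p)) +
        (\<Sum>j<m. real (hits (a j) (\<sigma> \<circ> filling p)))"
      using count_filling_le[OF p \<sigma>] by (simp only: of_nat_le_iff flip: of_nat_add of_nat_sum)
    moreover have "0 \<le> real (outer_count (\<sigma> \<circ> filling p)) + (\<Sum>j<m. real (hits (a j) (\<sigma> \<circ> filling p)))"
      by (simp add: sum_nonneg)
    ultimately show ?thesis using below[OF p, of \<sigma>] by linarith
  qed
  then have "?S (\<lambda>p \<sigma>. \<bar>real (count (\<sigma> \<circ> filling p)) - real (inner_count \<sigma>)\<bar>) \<le>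
     ?S (\<lambda>p \<sigma>. real (outer_count (\<sigma> \<circ> filling p)) + (\<Sum>j<m. real (hits (a j) (\<sigma> \<circ> filling p))) + real (near p \<sigma>))"
    by (intro sum_mono)
  also have "\<dots> = O' + H + R"
    by (simp only: sum.distrib O'_def H_def R_def split)
  also have "\<dots> \<le> 2 * load * total + load * total + load * (2 * total)"
    using O_le H_eq R_le mult_left_mono[OF I_le load0] by linarith
  finally show ?thesis by simp
qed

definition mean :: real where
  "mean = total / fact N"

definition charfun :: "real \<Rightarrow> complex" where
  "charfun t = (\<Sum>\<sigma>\<in>perms. iexp (t * real (count \<sigma>))) / fact N"

section \<open>Poisson approximation of the characteristic function\<close>

text \<open>The quotient by \<open>fact N\<close> on the left is \<open>E (X exp(i t X))\<close>. Size biasing turns it into a sum over the vertex lists that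
  spell \<open>w\<close>; for each of them, since \<open>x \<mapsto> exp(i t x)\<close> is \<open>\<bar>t\<bar>\<close>-Lipschitz, the coupling allows \<open>inner_count\<close>
  to be replaced by \<open>count\<close>.\<close>
theorem size_bias_bound:
  assumes small: "load \<le> 1 / 2"
  shows "cmod ((\<Sum>\<sigma>\<in>perms. of_nat (count \<sigma>) * iexp (t * real (count \<sigma>))) / fact N
      - mean * iexp t * charfun t) \<le> mean * \<bar>t\<bar> * (5 * load * mean)"
proof -
  let ?K = "real (card placements)" and ?A = "real (card spelling)"
  let ?e = "\<lambda>k :: nat. iexp (t * real k)"
  let ?Z = "\<lambda>a. \<Sum>\<sigma>\<in>extending a. ?e (inner_count \<sigma>)"
  let ?X = "\<Sum>\<sigma>\<in>perms. ?e (count \<sigma>)"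
  have card0: "card perms = card placements * card (extending a)" if "a \<in> spelling" for a
    using card_extending that by (simp add: card_perms spelling_def)
  have K: "?K > 0"
  proof -
    have "restrict id {..<m} \<in> placements" using m_le by (auto simp: placements_def)
    then show ?thesis by (auto simp: card_gt_0_iff)
  qed
  have lip: "cmod (of_real ?K * ?Z a - ?X) \<le> \<bar>t\<bar> * (5 * load * total)" if a: "a \<in> spelling" for a
  proof -
    have "?X = (\<Sum>p\<in>placements. \<Sum>\<sigma>\<in>extending a. ?e (count (\<sigma> \<circ> filling p)))"
      using a by (intro sum_perms_split) (simp add: spelling_def)
    then have diff: "of_real ?K * ?Z a - ?X =
        (\<Sum>p\<in>placements. \<Sum>\<sigma>\<in>extending a. ?e (inner_count \<sigma>) - ?e (count (\<sigma> \<circ> filling p)))"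
      by (simp add: sum_subtractf)
    have "cmod (of_real ?K * ?Z a - ?X) \<le> (\<Sum>p\<in>placements. \<Sum>\<sigma>\<in>extending a. \<bar>t\<bar> * \<bar>real (count (\<sigma> \<circ> filling p)) - real (inner_count \<sigma>)\<bar>)"
      unfolding diff
    proof (intro sum_norm_le)
      fix p \<sigma>
      let ?x = "t * real (inner_count \<sigma>)" and ?y = "t * real (count (\<sigma> \<circ> filling p))"
      have "iexp ?x - iexp ?y = iexp ?y * (iexp (?x - ?y) - 1)"
        by (simp add: algebra_simps flip: exp_add)
      then have "cmod (iexp ?x - iexp ?y) = cmod (iexp (?x - ?y) - 1)" by (simp add: norm_mult)
      also have "\<dots> \<le> \<bar>?x - ?y\<bar>" using iexp_approx1[of "?x - ?y" 0] by simp
      also have "\<dots> = \<bar>t\<bar> * \<bar>real (count (\<sigma> \<circ> filling p)) - real (inner_count \<sigma>)\<bar>"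
        by (simp add: abs_minus_commute flip: right_diff_distrib abs_mult)
      finally show "cmod (?e (inner_count \<sigma>) - ?e (count (\<sigma> \<circ> filling p))) \<le> \<dots>" .
    qed
    also have "\<dots> = \<bar>t\<bar> * (\<Sum>p\<in>placements. \<Sum>\<sigma>\<in>extending a. \<bar>real (count (\<sigma> \<circ> filling p)) - real (inner_count \<sigma>)\<bar>)"
      by (simp only: sum_distrib_left)
    also have "\<dots> \<le> \<bar>t\<bar> * (5 * load * total)"
      using coupling_bound[OF a small] by (rule mult_left_mono) simp
    finally show ?thesis .
  qed
  have lhs: "(\<Sum>\<sigma>\<in>perms. of_nat (count \<sigma>) * ?e (count \<sigma>)) = of_nat N * iexp t * (\<Sum>a\<in>spelling. ?Z a)"
  proof -
    have "(\<Sum>\<sigma>\<in>perms. of_nat (count \<sigma>) * ?e (count \<sigma>)) =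
        of_nat N * (\<Sum>a\<in>spelling. \<Sum>\<sigma>\<in>extending a. ?e (count \<sigma>))"
      by (simp only: sum_count_times[of ?e] sum_occ_0)
    also have "(\<Sum>a\<in>spelling. \<Sum>\<sigma>\<in>extending a. ?e (count \<sigma>)) =
        (\<Sum>a\<in>spelling. \<Sum>\<sigma>\<in>extending a. iexp t * ?e (inner_count \<sigma>))"
      by (intro sum.cong refl) (simp add: count_extending algebra_simps flip: exp_add)
    finally show ?thesis by (simp add: sum_distrib_left mult.assoc)
  qed
  have total: "total * ?K = real N * ?A * fact N"
  proof -
    have "total = real N * (\<Sum>a\<in>spelling. real (card (extending a)))"
      using sum_count_times[of "\<lambda>_. 1::real"] unfolding total_def
      by (simp only: mult_1_right sum_occ_0[of "\<lambda>_. 1::real", simplified mult_1_right] sum_constant)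
    then have "total * ?K = real N * (\<Sum>a\<in>spelling. real (card placements * card (extending a)))"
      by (simp add: sum_distrib_left mult_ac)
    also have "\<dots> = real N * (\<Sum>a\<in>spelling. fact N)"
      using card_extending by (intro arg_cong2[where f = "(*)"] sum.cong refl) (simp add: spelling_def flip: of_nat_mult)
    finally show ?thesis by simp
  qed
  have "total = real N * ?A * fact N / ?K" using total K by (metis less_irrefl nonzero_mult_div_cancel_right)
  then have mean: "mean = real N * ?A / ?K" by (simp add: mean_def)
  have diff: "of_real ?K * (\<Sum>a\<in>spelling. ?Z a) - of_real ?A * ?X = (\<Sum>a\<in>spelling. of_real ?K * ?Z a - ?X)"
    by (simp add: sum_subtractf sum_distrib_left)
  have "cmod (\<Sum>a\<in>spelling. of_real ?K * ?Z a - ?X) \<le> (\<Sum>a\<in>spelling. \<bar>t\<bar> * (5 * load * total))"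
    using lip by (rule sum_norm_le)
  then have main: "cmod (of_real ?K * (\<Sum>a\<in>spelling. ?Z a) - of_real ?A * ?X) \<le> ?A * (\<bar>t\<bar> * (5 * load * total))"
    unfolding diff by simp
  have final: "(\<Sum>\<sigma>\<in>perms. of_nat (count \<sigma>) * ?e (count \<sigma>)) / fact N - mean * iexp t * charfun t =
     of_real (real N / (?K * fact N)) * iexp t * (of_real ?K * (\<Sum>a\<in>spelling. ?Z a) - of_real ?A * ?X)"
  proof -
    have alg: "n * e * Z / F - n * A / k * e * (X / F) = n / (k * F) * e * (k * Z - A * X)"
      if "k \<noteq> 0" "F \<noteq> 0" for n e Z F A k X :: complex
      using that by (simp add: field_simps)
    have K': "complex_of_real ?K \<noteq> 0" "(fact N :: complex) \<noteq> 0" using K by auto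
    show ?thesis
      using alg[OF K', of "of_nat N" "iexp t" "\<Sum>a\<in>spelling. ?Z a" "of_real ?A" ?X]
      unfolding lhs mean charfun_def by simp
  qed
  have "cmod (of_real (real N / (?K * fact N)) * iexp t * (of_real ?K * (\<Sum>a\<in>spelling. ?Z a) - of_real ?A * ?X))
      = real N / (?K * fact N) * cmod (of_real ?K * (\<Sum>a\<in>spelling. ?Z a) - of_real ?A * ?X)"
    unfolding norm_mult norm_of_real norm_exp_i_times using K by simp
  also have "\<dots> \<le> real N / (?K * fact N) * (?A * (\<bar>t\<bar> * (5 * load * total)))"
    using K by (intro mult_left_mono main) simp
  also have "\<dots> = (real N * ?A / ?K) * \<bar>t\<bar> * (5 * load * (total / fact N))"
    by (simp add: field_simps)
  also have "\<dots> = mean * \<bar>t\<bar> * (5 * load * mean)"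
    by (simp only: mean[symmetric] mean_def[symmetric])
  finally show ?thesis unfolding final .
qed

end

lemma iexp_has_vector_derivative:
  "((\<lambda>s. iexp (s * c)) has_vector_derivative \<i> * c * iexp (s * c)) (at s)"
proof -
  have "((\<lambda>z. exp (\<i> * (z * complex_of_real c))) has_field_derivative \<i> * c * iexp (s * c)) (at (of_real s))"
    by (auto intro!: derivative_eq_intros)
  from has_vector_derivative_real_field[OF this] show ?thesis by simp
qed

text \<open>Variation of constants: divide by the solution \<open>exp(\<mu> (exp(i s) - 1))\<close>, whose modulus is
  \<open>exp(- \<mu> (1 - cos s))\<close>, and bound the derivative of the quotient. The error committed at \<open>s\<close> reaches \<open>t\<close> with the
  factor \<open>exp(\<mu> (cos t - cos s))\<close>, which \<open>exp G\<close> bounds. It is at most \<open>1\<close> for \<open>\<bar>s\<bar> \<le> \<bar>t\<bar> \<le> \<pi>\<close>, which keeps the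
  bound useful for large \<open>\<mu>\<close>.\<close>
lemma poisson_comparison:
  fixes \<phi> \<phi>' :: "real \<Rightarrow> complex"
  assumes deriv: "\<And>s. (\<phi> has_vector_derivative \<phi>' s) (at s)" and "\<phi> 0 = 1"
    and eqn: "\<And>s. cmod (\<phi>' s - \<i> * \<mu> * iexp s * \<phi> s) \<le> \<mu> * \<bar>s\<bar> * \<delta>"
    and nonneg: "0 \<le> \<mu>" "0 \<le> \<delta>"
    and G: "\<And>s. \<bar>s\<bar> \<le> \<bar>t\<bar> \<Longrightarrow> \<mu> * (cos t - cos s) \<le> G"
  shows "cmod (\<phi> t - exp (\<mu> * (iexp t - 1))) \<le> \<mu> * \<delta> * t\<^sup>2 * exp G"
proof -
  define E where "E s = exp (- (complex_of_real \<mu> * (iexp s - 1)))" for s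
  define F where "F s = \<phi> s * E s" for s
  define F' where "F' s = (\<phi>' s - \<i> * \<mu> * iexp s * \<phi> s) * E s" for s
  let ?B = "\<mu> * \<bar>t\<bar> * \<delta> * exp (\<mu> * (1 - cos t) + G)"
  have norm_E: "cmod (E s) = exp (\<mu> * (1 - cos s))" for s
    by (simp add: E_def norm_exp algebra_simps flip: cis_conv_exp)
  have iexp_deriv: "(iexp has_vector_derivative \<i> * iexp s) (at s)" for s
    using iexp_has_vector_derivative[of 1 s] by simp
  have "(E has_vector_derivative (- (\<mu> * (\<i> * iexp s)) * E s)) (at s)" for s
    unfolding E_def
    by (rule field_vector_diff_chain_at[where f = "\<lambda>s. - (complex_of_real \<mu> * (iexp s - 1))" and g = exp, unfolded o_def, THEN has_vector_derivative_eq_rhs])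
       (auto intro!: derivative_eq_intros iexp_deriv)
  then have F_deriv: "(F has_vector_derivative F' s) (at s)" for s
    unfolding F_def
    by (rule has_vector_derivative_mult[OF deriv, THEN has_vector_derivative_eq_rhs])
       (simp add: F'_def algebra_simps)
  have F'_le: "cmod (F' s) \<le> ?B" if s: "s \<in> {- \<bar>t\<bar>..\<bar>t\<bar>}" for s
  proof -
    have st: "\<bar>s\<bar> \<le> \<bar>t\<bar>" using s by auto
    have "cmod (F' s) \<le> \<mu> * \<bar>s\<bar> * \<delta> * exp (\<mu> * (1 - cos s))"
      unfolding F'_def norm_mult norm_E by (intro mult_right_mono eqn) simp
    also have "\<dots> \<le> ?B"
      using G[OF st] st nonneg by (intro mult_mono) (auto simp: algebra_simps)
    finally show ?thesis .
  qed
  have "cmod (F t - F 0) \<le> ?B * norm (t - 0)"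
  proof (rule differentiable_bound[where S = "{- \<bar>t\<bar>..\<bar>t\<bar>}" and f' = "\<lambda>s h. h *\<^sub>R F' s"])
    show "(F has_derivative (\<lambda>h. h *\<^sub>R F' s)) (at s within {- \<bar>t\<bar>..\<bar>t\<bar>})" for s
      using F_deriv[of s] has_derivative_at_withinI unfolding has_vector_derivative_def by blast
    show "onorm (\<lambda>h. h *\<^sub>R F' s) \<le> ?B" if "s \<in> {- \<bar>t\<bar>..\<bar>t\<bar>}" for s
      using F'_le[OF that] by (intro onorm_le) (auto simp: mult.commute intro: mult_left_mono)
  qed auto
  moreover have "F 0 = 1" using assms(2) by (simp add: F_def E_def)
  moreover have "\<phi> t - exp (\<mu> * (iexp t - 1)) = exp (\<mu> * (iexp t - 1)) * (F t - 1)"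
  proof -
    have "exp (\<mu> * (iexp t - 1)) * E t = 1" unfolding E_def by (rule exp_minus_inverse)
    then show ?thesis by (simp add: F_def right_diff_distrib mult.left_commute)
  qed
  moreover have "cmod (exp (\<mu> * (iexp t - 1))) = exp (- \<mu> * (1 - cos t))"
    by (simp add: norm_exp algebra_simps flip: cis_conv_exp)
  ultimately have "cmod (\<phi> t - exp (\<mu> * (iexp t - 1))) \<le> exp (- \<mu> * (1 - cos t)) * (?B * \<bar>t\<bar>)"
    by (simp add: norm_mult)
  also have "\<dots> = \<mu> * \<delta> * t\<^sup>2 * exp G"
  proof -
    have "exp (- \<mu> * (1 - cos t)) * exp (\<mu> * (1 - cos t) + G) = exp G"
      by (simp add: algebra_simps flip: exp_add)
    moreover have "\<bar>t\<bar> * \<bar>t\<bar> = t\<^sup>2" by (simp add: power2_eq_square)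
    ultimately show ?thesis by (metis (no_types, opaque_lifting) mult.assoc mult.commute)
  qed
  finally show ?thesis .
qed

context random_arrangement begin

lemma charfun_deriv:
  "(charfun has_vector_derivative
     (\<i> * ((\<Sum>\<sigma>\<in>perms. of_nat (count \<sigma>) * iexp (s * real (count \<sigma>))) / fact N))) (at s)"
proof -
  have "((\<lambda>s. \<Sum>\<sigma>\<in>perms. iexp (s * real (count \<sigma>))) has_vector_derivative
      (\<Sum>\<sigma>\<in>perms. \<i> * complex_of_real (real (count \<sigma>)) * iexp (s * real (count \<sigma>)))) (at s)"
    by (intro has_vector_derivative_sum iexp_has_vector_derivative)
  from has_vector_derivative_divide[OF this, of "fact N"]
  show ?thesis unfolding charfun_def[abs_def] by (simp add: sum_distrib_left mult.assoc)
qed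

lemma charfun_poisson_bound:
  assumes small: "load \<le> 1 / 2" and load: "0 \<le> load"
    and G: "\<And>s. \<bar>s\<bar> \<le> \<bar>t\<bar> \<Longrightarrow> mean * (cos t - cos s) \<le> G"
  shows "cmod (charfun t - exp (mean * (iexp t - 1))) \<le> mean * (5 * load * mean) * t\<^sup>2 * exp G"
proof (rule poisson_comparison[OF charfun_deriv])
  show mean: "0 \<le> mean" by (simp add: mean_def total_def sum_nonneg)
  then show "0 \<le> 5 * load * mean" using load by simp
  show "charfun 0 = 1" by (simp add: charfun_def card_perms)
  fix s
  let ?D = "(\<Sum>\<sigma>\<in>perms. of_nat (count \<sigma>) * iexp (s * real (count \<sigma>))) / fact N"
  have "\<i> * ?D - \<i> * mean * iexp s * charfun s = \<i> * (?D - mean * iexp s * charfun s)"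
    by (simp add: algebra_simps)
  then have "cmod (\<i> * ?D - \<i> * mean * iexp s * charfun s) = cmod (?D - mean * iexp s * charfun s)"
    by (simp only: norm_mult norm_ii mult_1_left)
  then show "cmod (\<i> * ?D - \<i> * mean * iexp s * charfun s) \<le> mean * \<bar>s\<bar> * (5 * load * mean)"
    using size_bias_bound[OF small, of s] by simp
qed (rule G)

end

lemma char_poisson_dist:
  assumes "0 \<le> r"
  shows "char (distr (measure_pmf (poisson_dist r)) borel real) t = exp (r * (iexp t - 1))"
proof (cases "r = 0")
  case True
  then show ?thesis by (simp add: char_def integral_distr poisson_dist_def)
next
  case False
  then have r: "r > 0" using assms by simp
  have terms: "pmf (poisson_pmf r) k *\<^sub>R iexp (t * real k) = (r * iexp t) ^ k /\<^sub>R fact k * exp (- r)" for k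
    using r by (simp add: scaleR_conv_of_real power_mult_distrib exp_of_nat_mult[symmetric] field_simps exp_of_real)
  have sums: "(\<lambda>k. pmf (poisson_pmf r) k *\<^sub>R iexp (t * real k)) sums (exp (r * iexp t) * exp (- r))"
    unfolding terms by (intro sums_mult2 exp_converges)
  have "summable (\<lambda>k. r ^ k /\<^sub>R fact k * exp (- r))" by (intro summable_mult2 summable_exp_generic)
  then have "integrable (count_space UNIV) (\<lambda>k. pmf (poisson_pmf r) k *\<^sub>R iexp (t * real k))"
    using r unfolding integrable_count_space_nat_iff by (simp add: divide_inverse mult_ac)
  then have "(LINT k|measure_pmf (poisson_pmf r). iexp (t * real k)) = (\<Sum>k. pmf (poisson_pmf r) k *\<^sub>R iexp (t * real k))"
    by (simp add: measure_pmf_eq_density integral_density integral_count_space_nat)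
  also have "\<dots> = exp (r * (iexp t - 1))"
    using sums_unique[OF sums] by (simp add: algebra_simps exp_diff exp_minus exp_of_real divide_inverse)
  finally show ?thesis using False by (simp add: char_def integral_distr poisson_dist_def)
qed

text \<open>The central limit theorem for Poisson variables, by expanding \<open>exp(i u)\<close> to second order at
  \<open>u = t / \<surd>\<mu>\<close>.\<close>
lemma normalised_poisson_char_tendsto:
  assumes "filterlim \<mu> at_top sequentially"
  shows "(\<lambda>\<kappa>. iexp (- (t * sqrt (\<mu> \<kappa>))) * exp (\<mu> \<kappa> * (iexp (t / sqrt (\<mu> \<kappa>)) - 1)))
    \<longlonglongrightarrow> complex_of_real (exp (- (t\<^sup>2) / 2))"
proof -
  let ?u = "\<lambda>\<kappa>. t / sqrt (\<mu> \<kappa>)"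
  let ?e = "\<lambda>\<kappa>. \<mu> \<kappa> * (iexp (?u \<kappa>) - 1) - \<i> * (t * sqrt (\<mu> \<kappa>))"
  have pos: "\<forall>\<^sub>F \<kappa> in sequentially. 0 < \<mu> \<kappa>"
    using assms by (simp add: filterlim_at_top_dense)
  have lim: "(\<lambda>\<kappa>. \<bar>t\<bar> ^ 3 / sqrt (\<mu> \<kappa>)) \<longlonglongrightarrow> 0"
    by (intro tendsto_divide_0[OF tendsto_const] filterlim_at_top_imp_at_infinity
        filterlim_compose[OF sqrt_at_top assms])
  have expand: "complex_of_real (r\<^sup>2) * (iexp (t / r) - (\<Sum>k\<le>2. (\<i> * (t / r)) ^ k / fact k)) =
      r\<^sup>2 * (iexp (t / r) - 1) - \<i> * (t * r) - (- (t\<^sup>2) / 2)" if "0 < r" for r :: real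
  proof -
    have "(\<Sum>k\<le>2. (\<i> * (t / r)) ^ k / fact k) = 1 + \<i> * (t / r) + (\<i> * (t / r))\<^sup>2 / 2"
      by (simp add: numeral_2_eq_2)
    moreover have "complex_of_real (r\<^sup>2) * (\<i> * (t / r)) = \<i> * (t * r)"
      "complex_of_real (r\<^sup>2) * ((\<i> * (t / r))\<^sup>2 / 2) = - (t\<^sup>2) / 2"
      using that by (simp_all add: field_simps power2_eq_square)
    ultimately show ?thesis by (simp only: right_diff_distrib distrib_left) (simp add: algebra_simps)
  qed
  have "\<forall>\<^sub>F \<kappa> in sequentially. cmod (?e \<kappa> - (- (t\<^sup>2) / 2)) \<le> \<bar>t\<bar> ^ 3 / sqrt (\<mu> \<kappa>)"
    using pos
  proof eventually_elim
    case (elim \<kappa>)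
    let ?s = "sqrt (\<mu> \<kappa>)"
    have s: "?s > 0" "\<mu> \<kappa> = ?s\<^sup>2" using elim by auto
    have "\<mu> \<kappa> * (iexp (?u \<kappa>) - (\<Sum>k\<le>2. (\<i> * ?u \<kappa>) ^ k / fact k)) = ?e \<kappa> - (- (t\<^sup>2) / 2)"
      using expand[OF s(1)] by (simp only: s(2)[symmetric])
    moreover have "cmod (\<mu> \<kappa> * (iexp (?u \<kappa>) - (\<Sum>k\<le>2. (\<i> * ?u \<kappa>) ^ k / fact k))) \<le> \<mu> \<kappa> * (\<bar>?u \<kappa>\<bar> ^ Suc 2 / fact (Suc 2))"
      unfolding norm_mult using iexp_approx1[of "?u \<kappa>" 2] elim by (intro mult_mono) auto
    moreover have "\<mu> \<kappa> * (\<bar>?u \<kappa>\<bar> ^ Suc 2 / fact (Suc 2)) = \<bar>t\<bar> ^ 3 / ?s / 6"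
      using s(1) by (subst s(2)) (simp add: fact_numeral power_divide field_simps numeral_3_eq_3 numeral_2_eq_2)
    moreover have "\<bar>t\<bar> ^ 3 / ?s / 6 \<le> \<bar>t\<bar> ^ 3 / ?s" using s(1) by (simp add: field_simps)
    ultimately show ?case by simp
  qed
  then have "(\<lambda>\<kappa>. ?e \<kappa> - (- (t\<^sup>2) / 2)) \<longlonglongrightarrow> 0" by (rule Lim_null_comparison) (rule lim)
  then have "?e \<longlonglongrightarrow> - (t\<^sup>2) / 2" by (rule LIM_zero_cancel)
  then have "(\<lambda>\<kappa>. exp (?e \<kappa>)) \<longlonglongrightarrow> exp (complex_of_real (- (t\<^sup>2) / 2))" by (rule tendsto_exp)
  moreover have "exp (?e \<kappa>) = iexp (- (t * sqrt (\<mu> \<kappa>))) * exp (\<mu> \<kappa> * (iexp (?u \<kappa>) - 1))" for \<kappa>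
    by (simp add: exp_diff exp_minus divide_inverse)
  ultimately show ?thesis by (simp only: exp_of_real)
qed

section \<open>Limit laws of fringe counts\<close>

text \<open>The naturals are discrete, so a convergent series has constant partial sums from some point on.\<close>
lemma finite_support_of_summable:
  fixes f :: "nat \<Rightarrow> nat"
  assumes "summable f"
  shows "finite {i. f i \<noteq> 0}"
proof -
  obtain s where "(\<lambda>k. \<Sum>i<k. f i) \<longlonglongrightarrow> s" using assms by (auto simp: summable_def sums_def)
  then have ev: "\<forall>\<^sub>F k in sequentially. (\<Sum>i<k. f i) = s" by (simp add: tendsto_discrete)
  then have "\<forall>\<^sub>F k in sequentially. (\<Sum>i<Suc k. f i) = s"
    by (rule eventually_sequentially_Suc[THEN iffD2])
  with ev have "\<forall>\<^sub>F k in sequentially. f k = 0" by eventually_elim simp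
  then have "finite {i. \<not> f i = 0}" by (simp add: cofinite_eq_sequentially[symmetric] eventually_cofinite)
  then show ?thesis .
qed

text \<open>Any list of the prescribed degrees; which arrangement it is does not matter, since it will be
  permuted uniformly.\<close>
lemma degree_statistic_word:
  assumes "is_degree_statistic n"
  obtains x where "\<And>i. count_list x i = n i" "length x = stat_size n" "excess x = -1"
proof -
  have fin: "finite {i. n i \<noteq> 0}"
    using assms finite_support_of_summable by (simp add: is_degree_statistic_def)
  define x where "x = concat (map (\<lambda>i. replicate (n i) i) (sorted_list_of_set {i. n i \<noteq> 0}))"
  let ?D = "{i. n i \<noteq> 0}"
  have sum_x: "sum_list (map g x) = (\<Sum>i\<in>?D. of_nat (n i) * g i)" for g :: "nat \<Rightarrow> int"
  proof -
    have "sum_list (map g (concat (map (\<lambda>i. replicate (n i) i) is))) = (\<Sum>i\<leftarrow>is. of_nat (n i) * g i)" for "is"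
      by (induction "is") (simp_all add: sum_list_replicate)
    then show ?thesis unfolding x_def using fin by (simp add: sum_list_distinct_conv_sum_set)
  qed
  have len: "int (length x) = (\<Sum>i\<in>?D. int (n i))" using sum_x[of "\<lambda>_. 1"] by (simp add: sum_list_triv)
  have size: "stat_size n = (\<Sum>i\<in>?D. n i)"
    unfolding stat_size_def by (rule suminf_finite) (use fin in auto)
  have "(\<Sum>i. i * n i) = (\<Sum>i\<in>?D. i * n i)" by (rule suminf_finite) (use fin in auto)
  then have ex: "(\<Sum>i\<in>?D. n i) = 1 + (\<Sum>i\<in>?D. i * n i)"
    using assms size by (simp add: is_degree_statistic_def stat_size_def)
  have "int (count_list x i) = int (n i)" for i
  proof -
    have "int (count_list x i) = sum_list (map (\<lambda>j. of_bool (j = i)) x)"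
      by (induction x) auto
    also have "\<dots> = (\<Sum>j\<in>?D. if j = i then int (n i) else 0)" unfolding sum_x by (intro sum.cong) auto
    also have "\<dots> = int (n i)" using fin by simp
    finally show ?thesis .
  qed
  then have "count_list x i = n i" for i by simp
  moreover have "length x = stat_size n" using len size by (simp flip: of_nat_sum)
  moreover have "excess x = int (\<Sum>i\<in>?D. i * n i) - int (\<Sum>i\<in>?D. n i)"
    unfolding sum_x by (simp add: sum_subtractf algebra_simps)
  then have "excess x = -1" using ex by linarith
  ultimately show ?thesis using that by blast
qed

lemma card_nth_eq_count_list: "card {j. j < length x \<and> x ! j = k} = count_list x k"
  by (simp add: count_list_eq_length_filter length_filter_conv_card eq_commute)

lemma integral_random_tree:
  fixes f :: "plane_tree \<Rightarrow> 'b :: {banach, second_countable_topology, real_normed_field}"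
  assumes "finite (trees_of_stat n)" "trees_of_stat n \<noteq> {}"
  shows "measure_pmf.expectation (random_tree n) f = (\<Sum>T\<in>trees_of_stat n. f T) / of_nat (card (trees_of_stat n))"
proof -
  have "measure_pmf.expectation (random_tree n) f = (\<Sum>T\<in>trees_of_stat n. pmf (random_tree n) T *\<^sub>R f T)"
    using assms by (intro integral_measure_pmf) (auto simp: random_tree_def)
  also have "\<dots> = (\<Sum>T\<in>trees_of_stat n. f T / of_nat (card (trees_of_stat n)))"
    using assms by (intro sum.cong refl) (simp add: random_tree_def pmf_of_set scaleR_conv_of_real)
  finally show ?thesis by (simp add: sum_divide_distrib)
qed

lemma real_distribution_distr_pmf: "real_distribution (distr (measure_pmf P) borel f)"
  by (rule prob_space.real_distribution_distr[OF measure_pmf.prob_space_axioms]) simp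

lemma char_distr_random_tree:
  "char (distr (measure_pmf (random_tree n)) borel f) t =
    measure_pmf.expectation (random_tree n) (\<lambda>T. iexp (t * f T))"
  by (simp add: char_def integral_distr)

lemma stat_size_degree_stat: "stat_size (degree_stat T) = tree_size T"
proof -
  let ?w = "preorder_degrees T"
  have "stat_size (degree_stat T) = (\<Sum>i\<in>set ?w. count_list ?w i)"
    unfolding stat_size_def by (subst suminf_finite[of "set ?w"]) (auto simp: degree_stat_eq count_list_0_iff)
  also have "\<dots> = tree_size T" by (simp add: tree_size_eq sum_count_set)
  finally show ?thesis .
qed

text \<open>The quantity \<open>\<epsilon>\<close> is \<open>\<mu>\<close> times the load \<open>\<Sum> t\<^sub>i\<^sup>2 / n\<^sub>i\<close>: the normalisations by the tree size and
  by the size of the statistic cancel.\<close>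
theorem fringe_count_poisson_bound:
  fixes n :: "nat \<Rightarrow> nat" and T' :: plane_tree
  defines "\<mu> \<equiv> mean_fringe_count T' n"
  defines "\<epsilon> \<equiv> (real (tree_size T'))\<^sup>2 * \<mu> / real (stat_size n) *
     (\<Sum>i\<in>degree_set T'. (stat_prob (degree_stat T') i)\<^sup>2 / stat_prob n i)"
  assumes n: "is_degree_statistic n" and \<mu>: "0 < \<mu>" and \<epsilon>: "2 * \<epsilon> \<le> \<mu>"
    and G: "\<And>s. \<bar>s\<bar> \<le> \<bar>t\<bar> \<Longrightarrow> \<mu> * (cos t - cos s) \<le> G"
  shows "cmod (char (distr (measure_pmf (random_tree n)) borel (\<lambda>T. real (fringe_count T' T))) t
      - exp (\<mu> * (iexp t - 1))) \<le> 5 * \<epsilon> * \<mu> * t\<^sup>2 * exp G"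
proof -
  obtain x where cnt: "\<And>i. count_list x i = n i" and len: "length x = stat_size n" and ex: "excess x = -1"
    using degree_statistic_word[OF n] by blast
  let ?N = "length x" and ?w = "preorder_degrees T'"
  let ?m = "length ?w"
  note trees = finite_nonempty_trees_of_stat[OF cnt ex]
  \<comment> \<open>otherwise \<open>T'\<close> does not fit into a tree of this size and its mean count is \<open>0\<close>\<close>
  have mle: "?m \<le> ?N"
  proof (rule ccontr)
    assume "\<not> ?m \<le> ?N"
    have "fringe_count T' T = 0" if "T \<in> trees_of_stat n" for T
    proof -
      have "length (preorder_degrees T) = ?N"
        using that mem_trees_of_stat_iff[OF cnt] mset_eq_length by blast
      then have "take ?m (drop s (preorder_degrees T)) \<noteq> ?w" for s
        using \<open>\<not> ?m \<le> ?N\<close> by (metis diff_le_self dual_order.trans length_drop length_take min.cobounded1)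
      then show ?thesis by (simp add: fringe_count_eq_card_factors)
    qed
    then have "\<mu> = 0" unfolding \<mu>_def mean_fringe_count_def by (simp add: integral_random_tree[OF trees])
    then show False using \<mu> by simp
  qed
  interpret random_arrangement ?N ?m "\<lambda>c. x ! c" "\<lambda>j. ?w ! j"
  proof
    show "0 < ?m" using preorder_degrees_nonempty by simp
    show "?m \<le> ?N" by (rule mle)
    fix s assume s: "0 < s" "s < ?m"
    show "\<exists>j<?m - s. ?w ! (s + j) \<noteq> ?w ! j"
    proof (rule ccontr)
      assume "\<not> ?thesis"
      then have "drop s ?w = take (?m - s) ?w" using s by (intro nth_equalityI) auto
      then show False using preorder_degrees_border_free[OF s] by blast
    qed
  qed
  have count_eq: "count \<sigma> = cyclic_occurrences ?w (permute_list \<sigma> x)" if "\<sigma> \<in> perms" for \<sigma>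
  proof -
    have per: "\<sigma> permutes {..<?N}" using that by (simp add: perms_def)
    have "occ \<sigma> s \<longleftrightarrow> take ?m (rotate s (permute_list \<sigma> x)) = ?w" for s
    proof -
      have "rotate s (permute_list \<sigma> x) ! j = x ! \<sigma> ((s + j) mod ?N)" if "j < ?m" for j
        using that mle N_pos per by (simp add: nth_rotate permute_list_nth)
      then show ?thesis using mle by (auto simp: occ_def list_eq_iff_nth_eq)
    qed
    then show ?thesis
      unfolding count_def cyclic_occurrences_def by (simp add: Int_def)
  qed
  have avg: "(\<Sum>T\<in>trees_of_stat n. h (fringe_count T' T)) / of_nat (card (trees_of_stat n)) =
      (\<Sum>\<sigma>\<in>perms. h (count \<sigma>)) / fact ?N" for h :: "nat \<Rightarrow> 'c :: field_char_0"
    using average_trees_eq_average_permutations[OF cnt ex mle, of h] count_eq by (simp add: perms_def)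
  have mean: "mean = \<mu>"
    unfolding mean_def total_def \<mu>_def mean_fringe_count_def integral_random_tree[OF trees]
    by (rule avg[of real, symmetric])
  have char: "char (distr (measure_pmf (random_tree n)) borel (\<lambda>T. real (fringe_count T' T))) t = charfun t"
    unfolding charfun_def char_distr_random_tree integral_random_tree[OF trees]
    by (rule avg[of "\<lambda>k. iexp (t * real k)"])
  have dem: "demand k = degree_stat T' k" for k
    by (simp add: demand_def degree_stat_eq card_nth_eq_count_list)
  have sto: "stock k = n k" for k by (simp add: stock_def card_nth_eq_count_list cnt)
  have deg: "degree_set T' = (\<lambda>j. ?w ! j) ` {..<?m}"
  proof -
    have "0 < count_list ?w k \<longleftrightarrow> k \<in> set ?w" for k using count_list_0_iff[of ?w k] by auto
    then show ?thesis by (auto simp: degree_set_def degree_stat_eq in_set_conv_nth)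
  qed
  have N: "real (stat_size n) > 0" using N_pos len by simp
  have m: "real ?m > 0" using m_pos by simp
  have "\<epsilon> = \<mu> * load"
  proof -
    have "(real (tree_size T'))\<^sup>2 * \<mu> / real (stat_size n) * ((stat_prob (degree_stat T') i)\<^sup>2 / stat_prob n i) =
        \<mu> * ((real (degree_stat T' i))\<^sup>2 / real (n i))" for i
    proof -
      have "stat_size (degree_stat T') = ?m"
        using stat_size_degree_stat by (simp add: tree_size_eq)
      then show ?thesis using N m by (simp add: stat_prob_def tree_size_eq power_divide)
    qed
    then show ?thesis unfolding \<epsilon>_def load_eq dem sto deg by (simp add: sum_distrib_left)
  qed
  moreover have "0 \<le> load" by (simp add: load_def sum_nonneg)
  ultimately show ?thesis
    using charfun_poisson_bound[of t G] G \<epsilon> \<mu> unfolding char mean by (simp add: mult_ac)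
qed
text \<open>Used for Poisson limits of mean \<open>0\<close>, where the condition that \<open>2 * \<epsilon>\<close> is at most the
  mean may fail.\<close>
lemma char_fringe_count_near_one:
  assumes n: "is_degree_statistic n"
  shows "cmod (char (distr (measure_pmf (random_tree n)) borel (\<lambda>T. real (fringe_count T' T))) t - 1)
    \<le> \<bar>t\<bar> * mean_fringe_count T' n"
proof -
  obtain x where "\<And>i. count_list x i = n i" "excess x = -1"
    using degree_statistic_word[OF n] by blast
  note trees = finite_nonempty_trees_of_stat[OF this]
  have "char (distr (measure_pmf (random_tree n)) borel (\<lambda>T. real (fringe_count T' T))) t - 1 =
      measure_pmf.expectation (random_tree n) (\<lambda>T. iexp (t * real (fringe_count T' T)) - 1)"
    using trees by (simp add: char_distr_random_tree integral_random_tree sum_subtractf diff_divide_distrib)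
  also have "cmod \<dots> \<le> measure_pmf.expectation (random_tree n) (\<lambda>T. cmod (iexp (t * real (fringe_count T' T)) - 1))"
    by (rule integral_norm_bound)
  also have "\<dots> \<le> measure_pmf.expectation (random_tree n) (\<lambda>T. \<bar>t\<bar> * real (fringe_count T' T))"
    unfolding integral_random_tree[OF trees]
  proof (intro divide_right_mono sum_mono)
    fix T
    show "cmod (iexp (t * real (fringe_count T' T)) - 1) \<le> \<bar>t\<bar> * real (fringe_count T' T)"
      using iexp_approx1[of "t * real (fringe_count T' T)" 0] by (simp add: abs_mult)
  qed simp
  also have "\<dots> = \<bar>t\<bar> * mean_fringe_count T' n" by (simp add: mean_fringe_count_def)
  finally show ?thesis .
qed

lemma char_normalised:
  assumes "0 \<le> \<mu>"
  shows "char (distr (measure_pmf P) borel (\<lambda>T. (X T - \<mu>) / sqrt \<mu>)) t =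
    iexp (- (t * sqrt \<mu>)) * char (distr (measure_pmf P) borel X) (t / sqrt \<mu>)"
proof -
  have "iexp (t * ((X T - \<mu>) / sqrt \<mu>)) = iexp (- (t * sqrt \<mu>)) * iexp (t / sqrt \<mu> * X T)" for T
  proof -
    have "t * ((X T - \<mu>) / sqrt \<mu>) = - (t * (\<mu> / sqrt \<mu>)) + t / sqrt \<mu> * X T"
      by (simp add: diff_divide_distrib algebra_simps)
    also have "\<mu> / sqrt \<mu> = sqrt \<mu>" using assms by (rule real_div_sqrt)
    finally show ?thesis by (simp only: of_real_add distrib_left exp_add)
  qed
  then show ?thesis by (simp add: char_def integral_distr)
qed

theorem corollary3p11:
  fixes n :: "nat \<Rightarrow> nat \<Rightarrow> nat" and p :: "nat pmf" and T :: "nat \<Rightarrow> plane_tree"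
  assumes "\<And>\<kappa>. \<kappa> \<ge> 1 \<Longrightarrow> is_degree_statistic (n \<kappa>)"
    and "filterlim (\<lambda>\<kappa>. stat_size (n \<kappa>)) at_top sequentially"
    and "\<And>i. (\<lambda>\<kappa>. stat_prob (n \<kappa>) i) \<longlonglongrightarrow> pmf p i"
    and "(\<lambda>\<kappa>. (real (tree_size (T \<kappa>)))\<^sup>2 * mean_fringe_count (T \<kappa>) (n \<kappa>) / real (stat_size (n \<kappa>))
            * (\<Sum>i\<in>degree_set (T \<kappa>).
                 (stat_prob (degree_stat (T \<kappa>)) i)\<^sup>2 / stat_prob (n \<kappa>) i))
         \<in> o(\<lambda>_. 1)"
  shows "(\<forall>\<mu>\<ge>0. (\<lambda>\<kappa>. mean_fringe_count (T \<kappa>) (n \<kappa>)) \<longlonglongrightarrow> \<mu> \<longrightarrow>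
           weak_conv_m
             (\<lambda>\<kappa>. distr (measure_pmf (random_tree (n \<kappa>))) borel (\<lambda>\<tau>. real (fringe_count (T \<kappa>) \<tau>)))
             (distr (measure_pmf (poisson_dist \<mu>)) borel real))
       \<and> (filterlim (\<lambda>\<kappa>. mean_fringe_count (T \<kappa>) (n \<kappa>)) at_top sequentially \<longrightarrow>
           weak_conv_m
             (\<lambda>\<kappa>. distr (measure_pmf (random_tree (n \<kappa>))) borel
                    (\<lambda>\<tau>. (real (fringe_count (T \<kappa>) \<tau>) - mean_fringe_count (T \<kappa>) (n \<kappa>))
                          / sqrt (mean_fringe_count (T \<kappa>) (n \<kappa>))))
             std_normal_distribution)"
proof (intro conjI allI impI)
  let ?\<mu> = "\<lambda>\<kappa>. mean_fringe_count (T \<kappa>) (n \<kappa>)"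
  let ?X = "\<lambda>\<kappa> \<tau>. real (fringe_count (T \<kappa>) \<tau>)"
  let ?\<phi> = "\<lambda>\<kappa>. char (distr (measure_pmf (random_tree (n \<kappa>))) borel (?X \<kappa>))"
  let ?P = "\<lambda>\<kappa> t. exp (?\<mu> \<kappa> * (iexp t - 1))"
  define \<epsilon> where "\<epsilon> \<kappa> = (real (tree_size (T \<kappa>)))\<^sup>2 * ?\<mu> \<kappa> / real (stat_size (n \<kappa>))
            * (\<Sum>i\<in>degree_set (T \<kappa>).
                 (stat_prob (degree_stat (T \<kappa>)) i)\<^sup>2 / stat_prob (n \<kappa>) i)" for \<kappa>
  have \<epsilon>: "\<epsilon> \<longlonglongrightarrow> 0"
    using smalloD_tendsto[OF assms(4)] by (simp add: \<epsilon>_def[abs_def])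
  have stat: "\<forall>\<^sub>F \<kappa> in sequentially. is_degree_statistic (n \<kappa>)"
    using eventually_ge_at_top[of 1] by eventually_elim (rule assms(1))
  have nonneg: "0 \<le> ?\<mu> \<kappa>" for \<kappa> by (simp add: mean_fringe_count_def)
  have bound: "cmod (?\<phi> \<kappa> t - ?P \<kappa> t) \<le> 5 * \<epsilon> \<kappa> * ?\<mu> \<kappa> * t\<^sup>2 * exp G"
    if "is_degree_statistic (n \<kappa>)" "0 < ?\<mu> \<kappa>" "2 * \<epsilon> \<kappa> \<le> ?\<mu> \<kappa>"
      "\<And>s. \<bar>s\<bar> \<le> \<bar>t\<bar> \<Longrightarrow> ?\<mu> \<kappa> * (cos t - cos s) \<le> G" for \<kappa> t G
    using fringe_count_poisson_bound[of "n \<kappa>" "T \<kappa>" t G] that unfolding \<epsilon>_def by blast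
  {
    fix \<mu> :: real
    assume \<mu>: "0 \<le> \<mu>" and lim: "?\<mu> \<longlonglongrightarrow> \<mu>"
    show "weak_conv_m (\<lambda>\<kappa>. distr (measure_pmf (random_tree (n \<kappa>))) borel (?X \<kappa>))
        (distr (measure_pmf (poisson_dist \<mu>)) borel real)"
    proof (rule levy_continuity)
      fix t
      have P_lim: "(\<lambda>\<kappa>. ?P \<kappa> t) \<longlonglongrightarrow> exp (\<mu> * (iexp t - 1))"
        by (intro tendsto_intros lim)
      have "(\<lambda>\<kappa>. ?\<phi> \<kappa> t) \<longlonglongrightarrow> exp (\<mu> * (iexp t - 1))"
      proof (cases "\<mu> = 0")
        case True
        have "\<forall>\<^sub>F \<kappa> in sequentially. cmod (?\<phi> \<kappa> t - 1) \<le> \<bar>t\<bar> * ?\<mu> \<kappa>"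
          using stat by eventually_elim (rule char_fringe_count_near_one)
        moreover have "(\<lambda>\<kappa>. \<bar>t\<bar> * ?\<mu> \<kappa>) \<longlonglongrightarrow> 0"
          using tendsto_mult_right_zero[OF lim[unfolded True]] .
        ultimately have "(\<lambda>\<kappa>. ?\<phi> \<kappa> t - 1) \<longlonglongrightarrow> 0" by (rule Lim_null_comparison)
        then show ?thesis using True by (simp add: LIM_zero_iff)
      next
        case False
        have "(\<lambda>\<kappa>. ?\<mu> \<kappa> - 2 * \<epsilon> \<kappa>) \<longlonglongrightarrow> \<mu> - 2 * 0" by (intro tendsto_intros lim \<epsilon>)
        then have "\<forall>\<^sub>F \<kappa> in sequentially. 0 < ?\<mu> \<kappa> - 2 * \<epsilon> \<kappa>"
          using \<mu> False by (intro order_tendstoD) auto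
        moreover have "\<forall>\<^sub>F \<kappa> in sequentially. 0 < ?\<mu> \<kappa>"
          using \<mu> False lim by (intro order_tendstoD) auto
        ultimately have "\<forall>\<^sub>F \<kappa> in sequentially. cmod (?\<phi> \<kappa> t - ?P \<kappa> t) \<le>
            5 * \<epsilon> \<kappa> * ?\<mu> \<kappa> * t\<^sup>2 * exp (?\<mu> \<kappa> * 2)"
          using stat
        proof eventually_elim
          case (elim \<kappa>)
          have "cos t - cos s \<le> 2" for s
            using cos_le_one[of t] cos_ge_minus_one[of s] by linarith
          then have "?\<mu> \<kappa> * (cos t - cos s) \<le> ?\<mu> \<kappa> * 2" for s
            using nonneg by (rule mult_left_mono)
          then show ?case using elim(1) by (intro bound elim(2,3)) simp
        qed
        moreover have "(\<lambda>\<kappa>. 5 * \<epsilon> \<kappa> * ?\<mu> \<kappa> * t\<^sup>2 * exp (?\<mu> \<kappa> * 2)) \<longlonglongrightarrow> 5 * 0 * \<mu> * t\<^sup>2 * exp (\<mu> * 2)"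
          by (intro tendsto_intros lim \<epsilon>)
        then have "(\<lambda>\<kappa>. 5 * \<epsilon> \<kappa> * ?\<mu> \<kappa> * t\<^sup>2 * exp (?\<mu> \<kappa> * 2)) \<longlonglongrightarrow> 0"
          by (simp only: mult_zero_left mult_zero_right)
        ultimately have "(\<lambda>\<kappa>. ?\<phi> \<kappa> t - ?P \<kappa> t) \<longlonglongrightarrow> 0"
          by (rule Lim_null_comparison)
        from tendsto_add[OF this P_lim] show ?thesis by (simp only: diff_add_cancel add_0)
      qed
      then show "(\<lambda>\<kappa>. ?\<phi> \<kappa> t) \<longlonglongrightarrow> char (distr (measure_pmf (poisson_dist \<mu>)) borel real) t"
        by (simp add: char_poisson_dist[OF \<mu>])
    qed (auto intro!: real_distribution_distr_pmf)
  }
  assume lim: "filterlim ?\<mu> at_top sequentially"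
  let ?s = "\<lambda>\<kappa>. sqrt (?\<mu> \<kappa>)"
  show "weak_conv_m (\<lambda>\<kappa>. distr (measure_pmf (random_tree (n \<kappa>))) borel (\<lambda>\<tau>. (?X \<kappa> \<tau> - ?\<mu> \<kappa>) / ?s \<kappa>))
      std_normal_distribution"
  proof (rule levy_continuity)
    fix t
    let ?u = "\<lambda>\<kappa>. t / ?s \<kappa>"
    have "?u \<longlonglongrightarrow> 0"
      by (intro tendsto_divide_0[OF tendsto_const] filterlim_at_top_imp_at_infinity
          filterlim_compose[OF sqrt_at_top lim])
    then have "(\<lambda>\<kappa>. \<bar>?u \<kappa>\<bar>) \<longlonglongrightarrow> 0" by (rule tendsto_rabs_zero)
    then have "\<forall>\<^sub>F \<kappa> in sequentially. \<bar>?u \<kappa>\<bar> < pi" by (rule order_tendstoD) simp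
    moreover have "\<forall>\<^sub>F \<kappa> in sequentially. 1 < ?\<mu> \<kappa>" using lim by (simp add: filterlim_at_top_dense)
    moreover have "\<forall>\<^sub>F \<kappa> in sequentially. \<epsilon> \<kappa> < 1 / 2" using \<epsilon> by (rule order_tendstoD) simp
    ultimately have "\<forall>\<^sub>F \<kappa> in sequentially. cmod (iexp (- (t * ?s \<kappa>)) * ?\<phi> \<kappa> (?u \<kappa>)
         - iexp (- (t * ?s \<kappa>)) * ?P \<kappa> (?u \<kappa>)) \<le> 5 * t\<^sup>2 * \<epsilon> \<kappa>"
      using stat
    proof eventually_elim
      case (elim \<kappa>)
      have "cos (?u \<kappa>) \<le> cos s" if "\<bar>s\<bar> \<le> \<bar>?u \<kappa>\<bar>" for s
        using cos_monotone_0_pi_le[OF abs_ge_zero that less_imp_le[OF elim(1)]]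
        by (simp only: cos_abs_real)
      then have "?\<mu> \<kappa> * (cos (?u \<kappa>) - cos s) \<le> 0" if "\<bar>s\<bar> \<le> \<bar>?u \<kappa>\<bar>" for s
        using that nonneg by (intro mult_nonneg_nonpos) simp_all
      then have "cmod (?\<phi> \<kappa> (?u \<kappa>) - ?P \<kappa> (?u \<kappa>)) \<le> 5 * \<epsilon> \<kappa> * ?\<mu> \<kappa> * (?u \<kappa>)\<^sup>2 * exp 0"
        using elim by (intro bound) auto
      also have "\<dots> = 5 * t\<^sup>2 * \<epsilon> \<kappa>" using elim by (simp add: power_divide)
      finally show ?case
        unfolding right_diff_distrib[symmetric] norm_mult norm_exp_i_times by simp
    qed
    moreover have "(\<lambda>\<kappa>. 5 * t\<^sup>2 * \<epsilon> \<kappa>) \<longlonglongrightarrow> 0" using tendsto_mult_right_zero[OF \<epsilon>] .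
    ultimately have "(\<lambda>\<kappa>. iexp (- (t * ?s \<kappa>)) * ?\<phi> \<kappa> (?u \<kappa>) - iexp (- (t * ?s \<kappa>)) * ?P \<kappa> (?u \<kappa>)) \<longlonglongrightarrow> 0"
      by (rule Lim_null_comparison)
    from tendsto_add[OF this normalised_poisson_char_tendsto[OF lim, of t]]
    have "(\<lambda>\<kappa>. iexp (- (t * ?s \<kappa>)) * ?\<phi> \<kappa> (?u \<kappa>)) \<longlonglongrightarrow> complex_of_real (exp (- (t\<^sup>2) / 2))"
      by (simp only: diff_add_cancel add_0)
    then show "(\<lambda>\<kappa>. char (distr (measure_pmf (random_tree (n \<kappa>))) borel (\<lambda>\<tau>. (?X \<kappa> \<tau> - ?\<mu> \<kappa>) / ?s \<kappa>)) t)
        \<longlonglongrightarrow> char std_normal_distribution t"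
      by (simp only: char_normalised[OF nonneg] char_std_normal_distribution)
  qed (auto intro!: real_distribution_distr_pmf real_dist_normal_dist)
qed

end
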